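(* Let $d\ge 1$, and let $f=\sum_{n\ge1}\sum_{i_1,\dots,i_n=1}^d \alpha_{(i_1,\dots,i_n)}z_{i_1}\cdots z_{i_n}$ and $g=\sum_{n\ge1}\sum_{i_1,\dots,i_n=1}^d \beta_{(i_1,\dots,i_n)}z_{i_1}\cdots z_{i_n}$ be polynomials without constant term, with complex coefficients, in non-commuting indeterminates $z_1,\dots,z_d$. Let $(A_1,\dots,A_d)$ be the $d$-tuple of left canonical operators with symbol $f$ and $(B_1,\dots,B_d)$ the $d$-tuple of right canonical operators with symbol $g$ on the full Fock space $\mathcal T_d$ over $\mathbb C^d$, and put $C_{i;\ell}:=A_i$, $C_{i;r}:=B_i$ for $1\le i\le d$. Let $\kappa_\chi$ denote the $(\ell,r)$-cumulant functionals of the noncommutative probability space $(B(\mathcal T_d),\varphi_{\mathrm{vac}})$. Let $n\ge1$, $\chi=(h_1,\dots,h_n)\in\{\ell,r\}^n$, and let $m_\ell(1)<\cdots<m_\ell(u)$ and $m_r(1)<\cdots<m_r(v)$ be the increasing lists of the elements of $\{m: h_m=\ell\}$ and of $\{m: h_m=r\}$, respectively. Then for all $i_1,\dots,i_n\in\{1,\dots,d\}$, $$\kappa_\chi(C_{i_1;h_1},\dots,C_{i_n;h_n})=\begin{cases}\alpha_{(i_{m_r(v)},\dots,i_{m_r(1)},\,i_{m_\ell(1)},\dots,i_{m_\ell(u)})}, & \text{if } h_n=\ell,\\[4pt] \beta_{(i_{m_\ell(u)},\dots,i_{m_\ell(1)},\,i_{m_r(1)},\dots,i_{m_r(v)})},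 & \text{if } h_n=r.\end{cases}$$
   Context: **Canonical operators.** Fix an orthonormal basis $e_1,\dots,e_d$ of $\mathbb C^d$. The full Fock space is $\mathcal T_d=\mathbb C\oplus\mathbb C^d\oplus(\mathbb C^d\otimes\mathbb C^d)\oplus\cdots\oplus(\mathbb C^d)^{\otimes n}\oplus\cdots$ (Hilbert space direct sum), with orthonormal basis $\{\xi_{\mathrm{vac}}\}\cup\{e_{i_1}\otimes\cdots\otimes e_{i_n}: n\ge1,\ 1\le i_1,\dots,i_n\le d\}$, where $\xi_{\mathrm{vac}}$ is a fixed unit vector of the summand $\mathbb C$. The vacuum state on $B(\mathcal T_d)$ is $\varphi_{\mathrm{vac}}(X)=\langle X\xi_{\mathrm{vac}},\xi_{\mathrm{vac}}\rangle$. The left and right creation operators $L_i,R_i\in B(\mathcal T_d)$ are the isometries with $L_i\xi_{\mathrm{vac}}=R_i\xi_{\mathrm{vac}}=e_i$, $L_i(e_{i_1}\otimes\cdots\otimes e_{i_n})=e_i\otimes e_{i_1}\otimes\cdots\otimes e_{i_n}$, $R_i(e_{i_1}\otimes\cdots\otimes e_{i_n})=e_{i_1}\otimes\cdots\otimes e_{i_n}\otimes e_i$. The left canonical operators with symbol $f$ are $$A_i:=L_i^*\Bigl(I+\sum_{n\ge1}\sum_{i_1,\dots,i_n=1}^d\alpha_{(i_1,\dots,i_n)}L_{i_n}\cdots L_{i_1}\Bigr),$$ and the right canonical operators with symbol $g$ are $$B_i:=R_i^*\Bigl(I+\sum_{n\ge1}\sum_{i_1,\dots,i_n=1}^d\beta_{(i_1,\dots,i_n)}R_{i_n}\cdots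 R_{i_1}\Bigr)$$ (finite sums, since $f,g$ are polynomials). **Lukasiewicz paths.** $\mathrm{Luk}(n)$ is the set of lattice paths $\lambda=((0,0),(1,j_1),\dots,(n,j_n))$ with all steps of the form $(1,i)$, $i\in\{-1,0,1,2,\dots\}$, with $j_m\ge0$ for all $m$ and $j_n=0$. The rise-vector of $\lambda$ is $(j_1,j_2-j_1,\dots,j_n-j_{n-1})$; it determines $\lambda$. **Output-time partitions.** Let $\lambda\in\mathrm{Luk}(n)$ have rise-vector $(p_1-1,\dots,p_n-1)$ with $p_i\in\{0,1,2,\dots\}$, and let $\chi=(h_1,\dots,h_n)\in\{\ell,r\}^n$. Consider $n$ balls labelled $1,\dots,n$ and a horizontal row (the deque), initially empty. For $i=1,\dots,n$ the $i$-th move is: insert the $p_i$ balls with labels $p_1+\cdots+p_{i-1}+1,\dots,p_1+\cdots+p_i$ one at a time, in increasing order of labels, at the left end of the deque if $h_i=\ell$, at the right end if $h_i=r$; then remove from the deque its leftmost ball if $h_i=\ell$, its rightmost ball if $h_i=r$; the removed ball has output time $i$. For each $i$ with $p_i>0$ let $T_i$ be the set of output times of the $p_i$ balls inserted in the $i$-th move. The output-time partition associated to $(\lambda,\chi)$ is $\Phi_\chi(\lambda):=\{T_i: 1\le i\le n,\ p_i>0\}$, a partition of $\{1,\dots,n\}$. Define $\mathcal P^{(\chi)}(n):=\{\Phi_\chi(\lambda):\lambda\in\mathrm{Luk}(n)\}$. **$(\ell,r)$-cumulants.** For a tuple $(x_1,\dots,x_n)$ and $V=\{i_1<\cdots<i_m\}\subseteq\{1,\dots,n\}$,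 put $(x_1,\dots,x_n)\mid V:=(x_{i_1},\dots,x_{i_m})$. For a noncommutative probability space $(\mathcal A,\varphi)$ (unital algebra over $\mathbb C$ with a linear functional $\varphi$, $\varphi(1)=1$), the $(\ell,r)$-cumulant functionals are the multilinear functionals $\kappa_\chi:\mathcal A^n\to\mathbb C$ ($n\ge1$, $\chi\in\{\ell,r\}^n$) uniquely determined by $$\varphi(a_1\cdots a_n)=\sum_{\pi\in\mathcal P^{(\chi)}(n)}\ \prod_{V\in\pi}\kappa_{\chi\mid V}\bigl((a_1,\dots,a_n)\mid V\bigr)$$ for all $n\ge1$, $\chi\in\{\ell,r\}^n$, $a_1,\dots,a_n\in\mathcal A$. *)

theory Defs
  imports "HOL-Analysis.Analysis" "HOL-Library.Poly_Mapping" "HOL-Library.Multiset"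
begin

section \<open>Square-summable families\<close>

text \<open>
  The Hilbert space of square-summable complex families indexed by a type, and its bounded
  complex-linear operators. The libraries only provide real inner products, so the complex structure
  is set up here; the induced real inner product is the real part of the complex one.
\<close>

typedef 'a ell2 = "{x :: 'a \<Rightarrow> complex. (\<lambda>a. (cmod (x a))\<^sup>2) summable_on UNIV}"
  morphisms coord Abs_ell2
  by (rule exI[of _ "\<lambda>_. 0"]) simp

setup_lifting type_definition_ell2

lemma ell2_eqI: "(\<And>a. coord x a = coord y a) \<Longrightarrow> x = y"
  by (metis coord_inject ext)

lemma ell2_add_closed:
  assumes "(\<lambda>a. (cmod (x a))\<^sup>2) summable_on UNIV" "(\<lambda>a. (cmod (y a))\<^sup>2) summable_on UNIV"
  shows "(\<lambda>a. (cmod (x a + y a))\<^sup>2) summable_on UNIV"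
proof (rule summable_on_comparison_test)
  show "(\<lambda>a. 2 * (cmod (x a))\<^sup>2 + 2 * (cmod (y a))\<^sup>2) summable_on UNIV"
    by (intro summable_on_add summable_on_cmult_right assms)
  fix a
  have "(cmod (x a + y a))\<^sup>2 \<le> (cmod (x a) + cmod (y a))\<^sup>2"
    by (intro power_mono norm_triangle_ineq norm_ge_zero)
  also have "\<dots> \<le> 2 * (cmod (x a))\<^sup>2 + 2 * (cmod (y a))\<^sup>2"
    using sum_squares_bound[of "cmod (x a)" "cmod (y a)"] by (simp add: power2_sum)
  finally show "(cmod (x a + y a))\<^sup>2 \<le> 2 * (cmod (x a))\<^sup>2 + 2 * (cmod (y a))\<^sup>2" .
qed auto

lemma ell2_scale_closed:
  assumes "(\<lambda>a. (cmod (x a))\<^sup>2) summable_on UNIV"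
  shows "(\<lambda>a. (cmod (c * x a))\<^sup>2) summable_on UNIV"
  using summable_on_cmult_right[OF assms, of "(cmod c)\<^sup>2"]
  by (simp add: norm_mult power_mult_distrib)

lift_definition scale_ell2 :: "complex \<Rightarrow> 'a ell2 \<Rightarrow> 'a ell2" (infixr \<open>*\<^sub>C\<close> 75)
  is "\<lambda>c x a. c * x a"
  by (rule ell2_scale_closed)

lift_definition cinner :: "'a ell2 \<Rightarrow> 'a ell2 \<Rightarrow> complex"
  is "\<lambda>x y. \<Sum>\<^sub>\<infinity>a. x a * cnj (y a)" .

lift_definition ket :: "'a \<Rightarrow> 'a ell2" is "\<lambda>a b. if b = a then 1 else 0"
proof -
  fix a :: 'a
  have "(\<lambda>b. (cmod (if b = a then 1 else 0))\<^sup>2) summable_on {a}"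
    by simp
  then show "(\<lambda>b. (cmod (if b = a then 1 else 0))\<^sup>2) summable_on UNIV"
    by (rule summable_on_cong_neutral[THEN iffD1, rotated -1]) auto
qed

lemma coord_scale [simp]: "coord (c *\<^sub>C x) a = c * coord x a"
  by transfer simp

lemma coord_ket: "coord (ket a) b = (if b = a then 1 else 0)"
  by transfer simp

lemma cinner_summable: "(\<lambda>a. coord x a * cnj (coord y a)) summable_on UNIV"
proof (rule abs_summable_summable, rule summable_on_comparison_test)
  show "(\<lambda>a. (cmod (coord x a))\<^sup>2 + (cmod (coord y a))\<^sup>2) summable_on UNIV"
    using coord[of x] coord[of y] by (intro summable_on_add) auto
  fix a
  show "cmod (coord x a * cnj (coord y a)) \<le> (cmod (coord x a))\<^sup>2 + (cmod (coord y a))\<^sup>2"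
    using sum_squares_bound[of "cmod (coord x a)" "cmod (coord y a)"]
      mult_nonneg_nonneg[OF norm_ge_zero norm_ge_zero, of "coord x a" "coord y a"]
    unfolding norm_mult complex_mod_cnj by linarith
qed auto

lemma cinner_eq: "cinner x y = (\<Sum>\<^sub>\<infinity>a. coord x a * cnj (coord y a))"
  by transfer simp

lemma cinner_commute: "cinner y x = cnj (cinner x y)"
  unfolding cinner_eq by (simp flip: infsum_cnj add: mult.commute)

lemma cinner_scale_left: "cinner (c *\<^sub>C x) y = c * cinner x y"
  unfolding cinner_eq by (simp add: mult.assoc infsum_cmult_right')

lemma cinner_self: "cinner x x = of_real (\<Sum>\<^sub>\<infinity>a. (cmod (coord x a))\<^sup>2)"
proof -
  have "cinner x x = (\<Sum>\<^sub>\<infinity>a. of_real ((cmod (coord x a))\<^sup>2))"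
    unfolding cinner_eq complex_norm_square ..
  also have "\<dots> = of_real (\<Sum>\<^sub>\<infinity>a. (cmod (coord x a))\<^sup>2)"
    by (rule infsumI, rule has_sum_of_real, rule has_sum_infsum) (use coord[of x] in auto)
  finally show ?thesis .
qed

lemma cinner_ket: "cinner x (ket a) = coord x a"
proof -
  have "cinner x (ket a) = (\<Sum>\<^sub>\<infinity>b\<in>{a}. coord x b * cnj (coord (ket a) b))"
    unfolding cinner_eq by (rule infsum_cong_neutral) (auto simp: coord_ket)
  then show ?thesis by (simp add: coord_ket)
qed

instantiation ell2 :: (type) real_inner
begin

lift_definition zero_ell2 :: "'a ell2" is "\<lambda>_. 0" by simp

lift_definition plus_ell2 :: "'a ell2 \<Rightarrow> 'a ell2 \<Rightarrow> 'a ell2" is "\<lambda>x y a. x a + y a"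
  by (rule ell2_add_closed)

lift_definition uminus_ell2 :: "'a ell2 \<Rightarrow> 'a ell2" is "\<lambda>x a. - x a"
  by simp

definition minus_ell2 :: "'a ell2 \<Rightarrow> 'a ell2 \<Rightarrow> 'a ell2" where
  "x - y = x + - (y :: 'a ell2)"

definition scaleR_ell2 :: "real \<Rightarrow> 'a ell2 \<Rightarrow> 'a ell2" where
  "r *\<^sub>R x = of_real r *\<^sub>C (x :: 'a ell2)"

definition inner_ell2 :: "'a ell2 \<Rightarrow> 'a ell2 \<Rightarrow> real" where
  "inner x y = Re (cinner x (y :: 'a ell2))"

definition norm_ell2 :: "'a ell2 \<Rightarrow> real" where
  "norm x = sqrt (inner x (x :: 'a ell2))"

definition sgn_ell2 :: "'a ell2 \<Rightarrow> 'a ell2" where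
  "sgn x = inverse (norm x) *\<^sub>R (x :: 'a ell2)"

definition dist_ell2 :: "'a ell2 \<Rightarrow> 'a ell2 \<Rightarrow> real" where
  "dist x y = norm (x - y :: 'a ell2)"

definition uniformity_ell2 :: "('a ell2 \<times> 'a ell2) filter" where
  "uniformity_ell2 = (INF e\<in>{0 <..}. principal {(x :: 'a ell2, y). dist x y < e})"

definition open_ell2 :: "'a ell2 set \<Rightarrow> bool" where
  "open_ell2 S = (\<forall>x\<in>S. \<forall>\<^sub>F (x', y) in uniformity. x' = x \<longrightarrow> y \<in> S)"

lemma coord_zero [simp]: "coord 0 a = 0"
  and coord_add [simp]: "coord (x + y) a = coord x a + coord y a"
  and coord_uminus [simp]: "coord (- x) a = - coord x a"
  and coord_diff [simp]: "coord (x - y) a = coord x a - coord y a"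
  and coord_scaleR [simp]: "coord (r *\<^sub>R x) a = of_real r * coord x a"
  unfolding minus_ell2_def scaleR_ell2_def by (transfer; simp)+

lemma cinner_add_left: "cinner (x + y) z = cinner x z + cinner y z"
  unfolding cinner_eq by (simp add: distrib_right infsum_add cinner_summable)

instance
proof
  fix x y z :: "'a ell2" and r s :: real
  show "x + y + z = x + (y + z)" "x + y = y + x" "0 + x = x" "- x + x = 0" "x - y = x + - y"
    "r *\<^sub>R (x + y) = r *\<^sub>R x + r *\<^sub>R y" "(r + s) *\<^sub>R x = r *\<^sub>R x + s *\<^sub>R x"
    "r *\<^sub>R s *\<^sub>R x = (r * s) *\<^sub>R x" "1 *\<^sub>R x = x"
    by (rule ell2_eqI; simp add: algebra_simps)+
  show "sgn x = inverse (norm x) *\<^sub>R x" by (rule sgn_ell2_def)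
  show "dist x y = norm (x - y)" by (rule dist_ell2_def)
  show "uniformity = (INF e\<in>{0<..}. principal {(x :: 'a ell2, y). dist x y < e})"
    by (rule uniformity_ell2_def)
  show "inner x y = inner y x"
    unfolding inner_ell2_def by (subst cinner_commute) simp
  show "inner (x + y) z = inner x z + inner y z"
    unfolding inner_ell2_def by (simp add: cinner_add_left)
  show "inner (r *\<^sub>R x) y = r * inner x y"
    unfolding inner_ell2_def scaleR_ell2_def by (simp add: cinner_scale_left)
  have eq: "inner x x = (\<Sum>\<^sub>\<infinity>a. (cmod (coord x a))\<^sup>2)"
    unfolding inner_ell2_def cinner_self by simp
  show "0 \<le> inner x x"
    unfolding eq by (rule infsum_nonneg) simp
  show "inner x x = 0 \<longleftrightarrow> x = 0"
  proof
    assume "inner x x = 0"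
    then have "(cmod (coord x a))\<^sup>2 = 0" for a
      unfolding eq by (rule nonneg_infsum_le_0D[OF eq_refl]) (use coord[of x] in auto)
    then show "x = 0" by (intro ell2_eqI) simp
  qed (simp add: inner_ell2_def cinner_eq)
  show "norm x = sqrt (inner x x)" by (rule norm_ell2_def)
  fix S :: "'a ell2 set"
  show "open S = (\<forall>x\<in>S. \<forall>\<^sub>F (x', y) in uniformity. x' = x \<longrightarrow> y \<in> S)"
    by (simp add: open_ell2_def)
qed

end

lemma norm_sq_ell2: "(norm x)\<^sup>2 = (\<Sum>\<^sub>\<infinity>a. (cmod (coord x a))\<^sup>2)"
  by (simp add: power2_norm_eq_inner inner_ell2_def cinner_self)

lemma norm_scale_ell2: "norm (c *\<^sub>C x) = cmod c * norm x"
proof (rule power2_eq_imp_eq)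
  show "(norm (c *\<^sub>C x))\<^sup>2 = (cmod c * norm x)\<^sup>2"
    by (simp add: norm_sq_ell2 norm_mult power_mult_distrib infsum_cmult_right')
qed simp_all


section \<open>Bounded operators\<close>

text \<open>
  A bounded real-linear map is bounded complex-linear iff it commutes with complex scalars.
\<close>

typedef 'a bop = "{T :: 'a ell2 \<Rightarrow> 'a ell2. bounded_linear T \<and> (\<forall>c x. T (c *\<^sub>C x) = c *\<^sub>C T x)}"
  morphisms bop_apply Abs_bop
  by (rule exI[of _ "\<lambda>_. 0"]) (auto intro: ell2_eqI)

setup_lifting type_definition_bop

lemma bop_eqI: "(\<And>x. bop_apply S x = bop_apply T x) \<Longrightarrow> S = T"
  by (metis bop_apply_inject ext)

lemma bop_apply_scale: "bop_apply T (c *\<^sub>C x) = c *\<^sub>C bop_apply T x"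
  using bop_apply[of T] by simp

lemma bounded_linear_bop: "bounded_linear (bop_apply T)"
  using bop_apply[of T] by simp

lemma scale_ell2_add_right: "c *\<^sub>C (x + y) = c *\<^sub>C x + c *\<^sub>C y"
  by (rule ell2_eqI) (simp add: algebra_simps)

lemma bounded_linear_scale_ell2: "bounded_linear (\<lambda>x. c *\<^sub>C x)"
  by (rule bounded_linear_intro[where K = "cmod c"])
    (auto intro!: ell2_eqI simp: norm_scale_ell2 algebra_simps)

instantiation bop :: (type) ring_1
begin

lift_definition zero_bop :: "'a bop" is "\<lambda>_. 0"
  by (auto intro: ell2_eqI)

lift_definition one_bop :: "'a bop" is "\<lambda>x. x"
  by (auto intro: bounded_linear_ident)

lift_definition plus_bop :: "'a bop \<Rightarrow> 'a bop \<Rightarrow> 'a bop" is "\<lambda>S T x. S x + T x"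
  by (auto intro: bounded_linear_add simp: scale_ell2_add_right)

lift_definition uminus_bop :: "'a bop \<Rightarrow> 'a bop" is "\<lambda>T x. - T x"
  by (auto intro!: bounded_linear_minus ell2_eqI)

definition minus_bop :: "'a bop \<Rightarrow> 'a bop \<Rightarrow> 'a bop" where
  "S - T = S + - (T :: 'a bop)"

lift_definition times_bop :: "'a bop \<Rightarrow> 'a bop \<Rightarrow> 'a bop" is "\<lambda>S T x. S (T x)"
  by (auto intro: bounded_linear_compose)

lemma bop_apply_simps [simp]:
  "bop_apply 0 x = 0" "bop_apply 1 x = x" "bop_apply (S + T) x = bop_apply S x + bop_apply T x"
    "bop_apply (- T) x = - bop_apply T x" "bop_apply (S - T) x = bop_apply S x - bop_apply T x"
    "bop_apply (S * T) x = bop_apply S (bop_apply T x)"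
  unfolding minus_bop_def by (transfer; simp)+

instance
proof
  fix R S T :: "'a bop"
  have lin: "bop_apply R (x + y) = bop_apply R x + bop_apply R y" for x y
    by (rule linear_add[OF bounded_linear.linear[OF bounded_linear_bop]])
  show "R + S + T = R + (S + T)" "R + S = S + R" "0 + R = R" "- R + R = 0" "R - S = R + - S"
    "R * S * T = R * (S * T)" "1 * R = R" "R * 1 = R" "(R + S) * T = R * T + S * T"
    "R * (S + T) = R * S + R * T"
    by (rule bop_eqI; simp add: lin)+
  have "coord (ket (undefined :: 'a)) undefined \<noteq> 0"
    by (simp add: coord_ket)
  then have "bop_apply (0 :: 'a bop) (ket undefined) \<noteq> bop_apply 1 (ket undefined)"
    by auto
  then show "(0 :: 'a bop) \<noteq> 1" by metis
qed

end

lift_definition scale_bop :: "complex \<Rightarrow> 'a bop \<Rightarrow> 'a bop" is "\<lambda>c T x. c *\<^sub>C T x"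
  by (auto intro!: bounded_linear_compose[OF bounded_linear_scale_ell2] ell2_eqI)

lemma bop_apply_scale_bop [simp]: "bop_apply (scale_bop c T) x = c *\<^sub>C bop_apply T x"
  by transfer simp

definition adj :: "'a bop \<Rightarrow> 'a bop" where
  "adj T = (THE S. \<forall>x y. cinner (bop_apply T x) y = cinner x (bop_apply S y))"

lemma adj_eqI:
  assumes "\<And>x y. cinner (bop_apply T x) y = cinner x (bop_apply S y)"
  shows "adj T = S"
  unfolding adj_def
proof (rule the_equality)
  fix S' assume S': "\<forall>x y. cinner (bop_apply T x) y = cinner x (bop_apply S' y)"
  show "S' = S"
  proof (rule bop_eqI, rule ell2_eqI)
    fix y a
    have "cinner (ket a) (bop_apply S' y) = cinner (ket a) (bop_apply S y)"
      using S' assms by metis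
    then have "cinner (bop_apply S' y) (ket a) = cinner (bop_apply S y) (ket a)"
      by (metis cinner_commute)
    then show "coord (bop_apply S' y) a = coord (bop_apply S y) a"
      by (simp add: cinner_ket)
  qed
qed (use assms in blast)


section \<open>Creation operators and canonical operators\<close>

text \<open>
  The letters of the finite type \<open>'d\<close> index the chosen orthonormal basis of the \<open>d\<close>-dimensional
  space, \<open>d\<close> being \<open>CARD('d)\<close>. The tensors of basis vectors, together with the vacuum vector,
  form an orthonormal basis of the full Fock space indexed by the words over \<open>'d\<close>, the empty word
  standing for the vacuum; so the full Fock space is taken in these coordinates.
\<close>

type_synonym 'd fock = "'d list ell2"

definition vacuum :: "'d fock" where
  "vacuum = ket []"

definition vacuum_state :: "'d list bop \<Rightarrow> complex" where
  "vacuum_state T = cinner (bop_apply T vacuum) vacuum"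

lemma shift_summable:
  fixes s :: "'a \<Rightarrow> 'a" and x y :: "'a \<Rightarrow> complex"
  assumes s: "inj s" and x: "(\<lambda>a. (cmod (x a))\<^sup>2) summable_on UNIV"
    and y: "\<And>v. y (s v) = x v" and y0: "\<And>w. w \<notin> range s \<Longrightarrow> y w = 0"
  shows "(\<lambda>a. (cmod (y a))\<^sup>2) summable_on UNIV"
    and "(\<Sum>\<^sub>\<infinity>a. (cmod (y a))\<^sup>2) = (\<Sum>\<^sub>\<infinity>a. (cmod (x a))\<^sup>2)"
proof -
  have "(\<lambda>a. (cmod (y a))\<^sup>2) summable_on range s \<longleftrightarrow> ((\<lambda>a. (cmod (y a))\<^sup>2) \<circ> s) summable_on UNIV"
    by (rule summable_on_reindex[OF s])
  then have "(\<lambda>a. (cmod (y a))\<^sup>2) summable_on range s"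
    using x by (simp add: o_def y)
  then show "(\<lambda>a. (cmod (y a))\<^sup>2) summable_on UNIV"
    by (rule summable_on_cong_neutral[THEN iffD1, rotated -1]) (auto simp: y0)
  have "(\<Sum>\<^sub>\<infinity>a. (cmod (y a))\<^sup>2) = (\<Sum>\<^sub>\<infinity>a\<in>range s. (cmod (y a))\<^sup>2)"
    by (rule infsum_cong_neutral) (auto simp: y0)
  also have "\<dots> = (\<Sum>\<^sub>\<infinity>a. (cmod (x a))\<^sup>2)"
    by (subst infsum_reindex[OF s]) (simp add: o_def y)
  finally show "(\<Sum>\<^sub>\<infinity>a. (cmod (y a))\<^sup>2) = (\<Sum>\<^sub>\<infinity>a. (cmod (x a))\<^sup>2)" .
qed

lemma range_cons: "w \<notin> range ((#) i) \<longleftrightarrow> w = [] \<or> hd w \<noteq> i"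
  by (cases w) auto

lemma range_snoc: "w \<notin> range (\<lambda>v. v @ [i]) \<longleftrightarrow> w = [] \<or> last w \<noteq> i"
  by (cases w rule: rev_cases) auto

lemma inj_snoc: "inj (\<lambda>v. v @ [i])"
  by (auto intro: injI)

lift_definition left_shift :: "'d \<Rightarrow> 'd fock \<Rightarrow> 'd fock"
  is "\<lambda>i x w. if w \<noteq> [] \<and> hd w = i then x (tl w) else 0"
  by (rule shift_summable(1)[where s = "(#) _"]) (auto simp: range_cons)

lift_definition right_shift :: "'d \<Rightarrow> 'd fock \<Rightarrow> 'd fock"
  is "\<lambda>i x w. if w \<noteq> [] \<and> last w = i then x (butlast w) else 0"
  by (rule shift_summable(1)[OF inj_snoc]) (auto simp: range_snoc)

lemma coord_left_shift:
  "coord (left_shift i x) w = (if w \<noteq> [] \<and> hd w = i then coord x (tl w) else 0)"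
  by transfer simp

lemma coord_right_shift:
  "coord (right_shift i x) w = (if w \<noteq> [] \<and> last w = i then coord x (butlast w) else 0)"
  by transfer simp

lemma norm_left_shift: "norm (left_shift i x) = norm x"
proof -
  have "(norm (left_shift i x))\<^sup>2 = (norm x)\<^sup>2"
    unfolding norm_sq_ell2
    by (rule shift_summable(2)[where s = "(#) i"])
      (use coord[of x] in \<open>auto simp: range_cons coord_left_shift\<close>)
  then show ?thesis by simp
qed

lemma norm_right_shift: "norm (right_shift i x) = norm x"
proof -
  have "(norm (right_shift i x))\<^sup>2 = (norm x)\<^sup>2"
    unfolding norm_sq_ell2
    by (rule shift_summable(2)[OF inj_snoc])
      (use coord[of x] in \<open>auto simp: range_snoc coord_right_shift\<close>)
  then show ?thesis by simp
qed

lift_definition left_creation :: "'d \<Rightarrow> 'd list bop" is left_shift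
  by (intro conjI allI bounded_linear_intro[where K = 1])
    (auto intro!: ell2_eqI simp: coord_left_shift norm_left_shift)

lift_definition right_creation :: "'d \<Rightarrow> 'd list bop" is right_shift
  by (intro conjI allI bounded_linear_intro[where K = 1])
    (auto intro!: ell2_eqI simp: coord_right_shift norm_right_shift)

lemma left_creation_ket: "bop_apply (left_creation i) (ket w) = ket (i # w)"
proof (rule ell2_eqI)
  fix v show "coord (bop_apply (left_creation i) (ket w)) v = coord (ket (i # w)) v"
    by (cases v) (auto simp: left_creation.rep_eq coord_left_shift coord_ket)
qed

lemma right_creation_ket: "bop_apply (right_creation i) (ket w) = ket (w @ [i])"
proof (rule ell2_eqI)
  fix v show "coord (bop_apply (right_creation i) (ket w)) v = coord (ket (w @ [i])) v"
    by (cases v rule: rev_cases) (auto simp: right_creation.rep_eq coord_right_shift coord_ket)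
qed

lemma creation_isometry:
  "norm (bop_apply (left_creation i) x) = norm x" "norm (bop_apply (right_creation i) x) = norm x"
  by (simp_all add: left_creation.rep_eq right_creation.rep_eq norm_left_shift norm_right_shift)

lemma coord_adj_shift:
  fixes s :: "'a \<Rightarrow> 'a" and T :: "'a bop"
  assumes s: "inj s" and T: "\<And>x v. coord (bop_apply T x) (s v) = coord x v"
    and T0: "\<And>x w. w \<notin> range s \<Longrightarrow> coord (bop_apply T x) w = 0"
  shows "coord (bop_apply (adj T) y) w = coord y (s w)"
proof -
  define S where "S y = Abs_ell2 (\<lambda>w. coord y (s w))" for y
  have sub: "(\<lambda>a. (cmod (coord y a))\<^sup>2) summable_on range s" for y
    by (rule summable_on_subset_banach[of _ UNIV]) (use coord[of y] in auto)
  have "(\<lambda>w. (cmod (coord y (s w)))\<^sup>2) summable_on UNIV" for y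
    using sub[of y] summable_on_reindex[OF s, of "\<lambda>a. (cmod (coord y a))\<^sup>2"] by (simp add: o_def)
  then have S: "coord (S y) w = coord y (s w)" for y w
    by (simp add: S_def Abs_ell2_inverse)
  have norm_S: "norm (S y) \<le> norm y" for y
  proof -
    have "(norm (S y))\<^sup>2 = (\<Sum>\<^sub>\<infinity>a\<in>range s. (cmod (coord y a))\<^sup>2)"
      unfolding norm_sq_ell2 by (subst infsum_reindex[OF s]) (simp add: o_def S)
    also have "\<dots> \<le> (norm y)\<^sup>2"
      unfolding norm_sq_ell2
      by (rule infsum_mono_neutral) (use coord[of y] sub[of y] in auto)
    finally show ?thesis by simp
  qed
  have bop_S: "bop_apply (Abs_bop S) = S"
  proof (rule Abs_bop_inverse, rule CollectI, intro conjI allI)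
    show "bounded_linear S"
      by (rule bounded_linear_intro[where K = 1]) (auto intro!: ell2_eqI simp: S norm_S)
    show "S (c *\<^sub>C x) = c *\<^sub>C S x" for c x
      by (rule ell2_eqI) (simp add: S)
  qed
  have "cinner (bop_apply T x) y = cinner x (S y)" for x y
  proof -
    have "cinner (bop_apply T x) y = (\<Sum>\<^sub>\<infinity>w\<in>range s. coord (bop_apply T x) w * cnj (coord y w))"
      unfolding cinner_eq by (rule infsum_cong_neutral) (auto simp: T0)
    also have "\<dots> = cinner x (S y)"
      unfolding cinner_eq by (subst infsum_reindex[OF s]) (simp add: o_def S T)
    finally show ?thesis .
  qed
  then have "adj T = Abs_bop S"
    by (intro adj_eqI) (simp add: bop_S)
  then show ?thesis by (simp add: bop_S S)
qed

lemma coord_adj_left_creation: "coord (bop_apply (adj (left_creation i)) y) w = coord y (i # w)"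
  by (rule coord_adj_shift[where s = "(#) i"])
    (auto simp: left_creation.rep_eq coord_left_shift range_cons)

lemma coord_adj_right_creation: "coord (bop_apply (adj (right_creation i)) y) w = coord y (w @ [i])"
  by (rule coord_adj_shift[where s = "\<lambda>w. w @ [i]"])
    (auto intro: injI simp: right_creation.rep_eq coord_right_shift range_snoc)

text \<open>
  A noncommutative polynomial is the finitely supported map from words to its coefficients. The
  coefficient of the word \<open>i\<^sub>1 \<dots> i\<^sub>n\<close> multiplies the product of creation operators in the
  reversed order \<open>i\<^sub>n \<dots> i\<^sub>1\<close>.
\<close>

definition left_canonical :: "('d list \<Rightarrow>\<^sub>0 complex) \<Rightarrow> 'd \<Rightarrow> 'd list bop" where
  "left_canonical f i = adj (left_creation i) *
     (1 + (\<Sum>w\<in>Poly_Mapping.keys f. scale_bop (Poly_Mapping.lookup f w) (prod_list (map left_creation (rev w)))))"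

definition right_canonical :: "('d list \<Rightarrow>\<^sub>0 complex) \<Rightarrow> 'd \<Rightarrow> 'd list bop" where
  "right_canonical g i = adj (right_creation i) *
     (1 + (\<Sum>w\<in>Poly_Mapping.keys g. scale_bop (Poly_Mapping.lookup g w) (prod_list (map right_creation (rev w)))))"


section \<open>Lukasiewicz paths and output-time partitions\<close>

text \<open>
  All indices (positions, moves, ball labels, output times) start from 0. A path
  \<open>((0,0), (1,j\<^sub>1), \<dots>, (n,j\<^sub>n))\<close> is represented by its list of heights \<open>[0, j\<^sub>1, \<dots>, j\<^sub>n]\<close>.
\<close>

datatype side = Lside | Rside

definition Luk :: "nat \<Rightarrow> int list set" where
  "Luk n = {js. length js = Suc n \<and> js ! 0 = 0 \<and> js ! n = 0 \<and> (\<forall>m\<le>n. 0 \<le> js ! m) \<and>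
     (\<forall>m<n. -1 \<le> js ! Suc m - js ! m)}"

text \<open>The vector \<open>(p\<^sub>1, \<dots>, p\<^sub>n)\<close> such that the rise-vector is \<open>(p\<^sub>1 - 1, \<dots>, p\<^sub>n - 1)\<close>.\<close>

definition insertions :: "int list \<Rightarrow> nat list" where
  "insertions js = map (\<lambda>m. nat (js ! Suc m - js ! m + 1)) [0..<length js - 1]"

fun insert_ball :: "side \<Rightarrow> nat \<Rightarrow> nat list \<Rightarrow> nat list" where
  "insert_ball Lside b q = b # q"
| "insert_ball Rside b q = q @ [b]"

fun end_ball :: "side \<Rightarrow> nat list \<Rightarrow> nat" where
  "end_ball Lside q = hd q"
| "end_ball Rside q = last q"

fun remove_ball :: "side \<Rightarrow> nat list \<Rightarrow> nat list" where
  "remove_ball Lside q = tl q"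
| "remove_ball Rside q = butlast q"

text \<open>
  The labels of the removed balls, in the order of removal, when the deque currently contains \<open>q\<close>
  and \<open>s\<close> is the next unused label.
\<close>

fun outputs :: "side list \<Rightarrow> nat list \<Rightarrow> nat \<Rightarrow> nat list \<Rightarrow> nat list" where
  "outputs (h # hs) (p # ps) s q =
     (let q' = fold (insert_ball h) [s..<s + p] q
      in end_ball h q' # outputs hs ps (s + p) (remove_ball h q'))"
| "outputs _ _ _ _ = []"

definition output_times :: "side list \<Rightarrow> nat list \<Rightarrow> nat \<Rightarrow> nat set" where
  "output_times chi ps i = {t. t < length chi \<and>
     outputs chi ps 0 [] ! t \<in> {sum_list (take i ps)..<sum_list (take (Suc i) ps)}}"

definition output_partition :: "side list \<Rightarrow> int list \<Rightarrow> nat set set" where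
  "output_partition chi js =
     {output_times chi (insertions js) i | i. i < length chi \<and> insertions js ! i > 0}"

definition lr_partitions :: "side list \<Rightarrow> nat set set set" where
  "lr_partitions chi = output_partition chi ` Luk (length chi)"


section \<open>Noncommutative probability spaces and cumulants\<close>

locale nc_probability_space = vector_space scale
  for scale :: "complex \<Rightarrow> 'a :: ring_1 \<Rightarrow> 'a" +
  fixes \<phi> :: "'a \<Rightarrow> complex"
  assumes scale_mult_left: "scale c (x * y) = scale c x * y"
    and scale_mult_right: "scale c (x * y) = x * scale c y"
    and linear_state: "Vector_Spaces.linear scale (*) \<phi>"
    and state_one: "\<phi> 1 = 1"

definition multilinear :: "(complex \<Rightarrow> 'a :: ab_group_add \<Rightarrow> 'a) \<Rightarrow> nat \<Rightarrow> ('a list \<Rightarrow> complex) \<Rightarrow> bool" where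
  "multilinear sc n F \<longleftrightarrow> (\<forall>as i. length as = n \<longrightarrow> i < n \<longrightarrow>
     Vector_Spaces.linear sc (*) (\<lambda>x. F (as[i := x])))"

text \<open>
  A family of functionals is a function of a side list and an argument list; only its values on
  nonempty lists of equal length are meaningful. The family is determined there, see
  \<open>lr_cumulants_exist\<close> and \<open>lr_cumulants_unique\<close> below.
\<close>

definition lr_cumulants ::
  "(complex \<Rightarrow> 'a :: ring_1 \<Rightarrow> 'a) \<Rightarrow> ('a \<Rightarrow> complex) \<Rightarrow> (side list \<Rightarrow> 'a list \<Rightarrow> complex) \<Rightarrow> bool" where
  "lr_cumulants sc \<phi> \<kappa> \<longleftrightarrow>
     (\<forall>chi. chi \<noteq> [] \<longrightarrow> multilinear sc (length chi) (\<kappa> chi)) \<and>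
     (\<forall>chi as. chi \<noteq> [] \<longrightarrow> length as = length chi \<longrightarrow>
        \<phi> (prod_list as) = (\<Sum>\<pi>\<in>lr_partitions chi. \<Prod>V\<in>\<pi>. \<kappa> (nths chi V) (nths as V)))"

lemma linear_functional_iff:
  assumes "vector_space sc"
  shows "Vector_Spaces.linear sc (*) F \<longleftrightarrow>
     (\<forall>x y. F (x + y) = F x + F y) \<and> (\<forall>c x. F (sc c x) = c * F x)"
proof -
  have "module sc" using assms by (simp only: module_iff_vector_space)
  then show ?thesis
    unfolding module_hom_iff_linear[symmetric] module_hom_iff
    using vector_space_over_itself.module_axioms by blast
qed

theorem nc_probability_space_fock:
  "nc_probability_space scale_bop (vacuum_state :: 'd list bop \<Rightarrow> complex)"
proof (intro nc_probability_space.intro nc_probability_space_axioms.intro)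
  show vs: "vector_space (scale_bop :: complex \<Rightarrow> 'd list bop \<Rightarrow> _)"
  proof
    fix a b :: complex and S T :: "'d list bop"
    show "scale_bop a (S + T) = scale_bop a S + scale_bop a T"
      "scale_bop (a + b) S = scale_bop a S + scale_bop b S"
      "scale_bop a (scale_bop b S) = scale_bop (a * b) S" "scale_bop 1 S = S"
      by (rule bop_eqI, rule ell2_eqI, simp add: algebra_simps)+
  qed
  show "Vector_Spaces.linear scale_bop (*) (vacuum_state :: 'd list bop \<Rightarrow> complex)"
    unfolding linear_functional_iff[OF vs]
    by (simp add: vacuum_state_def cinner_add_left cinner_scale_left)
  show "vacuum_state (1 :: 'd list bop) = 1"
    by (simp add: vacuum_state_def vacuum_def cinner_ket coord_ket)
  fix c and S T :: "'d list bop"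
  show "scale_bop c (S * T) = scale_bop c S * T"
    by (rule bop_eqI) simp
  show "scale_bop c (S * T) = S * scale_bop c T"
    by (rule bop_eqI) (simp add: bop_apply_scale)
qed


section \<open>Existence and uniqueness of the cumulants\<close>

lemma mset_insert_balls: "mset (fold (insert_ball h) bs q) = mset q + mset bs"
  by (induction bs arbitrary: q; cases h) auto

lemma mset_remove_ball: "q \<noteq> [] \<Longrightarrow> add_mset (end_ball h q) (mset (remove_ball h q)) = mset q"
proof (cases h)
  case Lside
  assume "q \<noteq> []"
  then show ?thesis using Lside by (cases q) auto
next
  case Rside
  assume "q \<noteq> []"
  then show ?thesis using Rside by (cases q rule: rev_cases) auto
qed

lemma mset_outputs:
  assumes "length hs = length ps" "length q + sum_list ps = length ps"
    "\<And>k. k < length ps \<Longrightarrow> k < length q + sum_list (take (Suc k) ps)"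
  shows "mset (outputs hs ps s q) = mset q + mset [s..<s + sum_list ps]"
  using assms
proof (induction hs ps s q rule: outputs.induct)
  case (1 h hs p ps s q)
  define q' where "q' = fold (insert_ball h) [s..<s + p] q"
  have mq': "mset q' = mset q + mset [s..<s + p]"
    unfolding q'_def by (rule mset_insert_balls)
  then have "size (mset q') = length q + p" by simp
  then have len: "length q' = length q + p" by simp
  have "q' \<noteq> []" using "1.prems"(3)[of 0] len by auto
  have "length (remove_ball h q') = length q' - 1" by (cases h) auto
  then have lr: "Suc (length (remove_ball h q')) = length q + p"
    using len \<open>q' \<noteq> []\<close> by (simp add: length_greater_0_conv[symmetric] del: length_greater_0_conv)
  have IH: "mset (outputs hs ps (s + p) (remove_ball h q'))
      = mset (remove_ball h q') + mset [s + p..<s + p + sum_list ps]"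
  proof (rule "1.IH"[OF q'_def])
    show "length hs = length ps" using "1.prems" by simp
    show "length (remove_ball h q') + sum_list ps = length ps"
      using "1.prems"(2) lr by simp
    fix k assume "k < length ps"
    then show "k < length (remove_ball h q') + sum_list (take (Suc k) ps)"
      using "1.prems"(3)[of "Suc k"] lr by simp
  qed
  have split: "[s..<s + sum_list (p # ps)] = [s..<s + p] @ [s + p..<s + p + sum_list ps]"
    using upt_add_eq_append[of s "s + p" "sum_list ps"] by (simp add: add.assoc)
  have "outputs (h # hs) (p # ps) s q = end_ball h q' # outputs hs ps (s + p) (remove_ball h q')"
    by (simp add: q'_def Let_def)
  then have "mset (outputs (h # hs) (p # ps) s q) = mset q' + mset [s + p..<s + p + sum_list ps]"
    by (simp only: mset.simps IH mset_remove_ball[OF \<open>q' \<noteq> []\<close>, of h, symmetric] union_mset_add_mset_left)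
  also have "\<dots> = mset q + mset [s..<s + sum_list (p # ps)]"
    unfolding split by (simp only: mq' mset_append add.assoc)
  finally show ?case .
qed auto

lemma length_insertions: "js \<in> Luk n \<Longrightarrow> length (insertions js) = n"
  by (simp add: insertions_def Luk_def)

lemma sum_insertions:
  assumes "js \<in> Luk n" "k \<le> n"
  shows "int (sum_list (take k (insertions js))) = js ! k + int k"
  using assms(2)
proof (induction k)
  case 0
  then show ?case using assms(1) by (simp add: Luk_def)
next
  case (Suc k)
  then have "insertions js ! k = nat (js ! Suc k - js ! k + 1)"
    using assms(1) by (simp add: insertions_def Luk_def)
  moreover have "-1 \<le> js ! Suc k - js ! k"
    using Suc.prems assms(1) by (simp add: Luk_def)
  moreover have "take (Suc k) (insertions js) = take k (insertions js) @ [insertions js ! k]"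
    using Suc.prems length_insertions[OF assms(1)] by (simp add: take_Suc_conv_app_nth)
  ultimately show ?case using Suc by simp
qed

lemma mset_outputs_Luk:
  assumes "js \<in> Luk (length chi)"
  shows "mset (outputs chi (insertions js) 0 []) = mset [0..<length chi]"
proof -
  let ?ps = "insertions js"
  have len: "length ?ps = length chi" by (rule length_insertions[OF assms])
  have "int (sum_list (take (length chi) ?ps)) = int (length chi)"
    using sum_insertions[OF assms order_refl] assms by (simp add: Luk_def)
  then have sum: "sum_list ?ps = length chi" using len by simp
  have "k < length [] + sum_list (take (Suc k) ?ps)" if "k < length ?ps" for k
  proof -
    have "0 \<le> js ! Suc k" using assms that len by (simp add: Luk_def)
    moreover have "int (sum_list (take (Suc k) ?ps)) = js ! Suc k + int (Suc k)"
      using that len by (intro sum_insertions[OF assms]) simp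
    ultimately show ?thesis by simp
  qed
  from mset_outputs[OF len[symmetric] _ this, of 0] show ?thesis
    using sum len by simp
qed

lemma partition_on_output_partition:
  assumes "js \<in> Luk (length chi)"
  shows "partition_on {..<length chi} (output_partition chi js)"
proof -
  let ?n = "length chi" and ?ps = "insertions js"
  define out where "out = outputs chi ?ps 0 []"
  define S where "S k = sum_list (take k ?ps)" for k
  have len: "length ?ps = ?n" by (rule length_insertions[OF assms])
  have m: "mset out = mset [0..<?n]"
    unfolding out_def by (rule mset_outputs_Luk[OF assms])
  have set_out: "set out = {..<?n}"
    using mset_eq_setD[OF m] by (simp only: set_upt atLeast0LessThan)
  have len_out: "length out = ?n"
    using mset_eq_length[OF m] by (simp only: length_upt minus_nat.diff_0)
  have Suc_S: "S (Suc k) = S k + ?ps ! k" if "k < ?n" for k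
    using that len by (simp add: S_def take_Suc_conv_app_nth)
  have S0: "S 0 = 0" by (simp add: S_def)
  have "int (S ?n) = int ?n"
    unfolding S_def using sum_insertions[OF assms order_refl] assms by (simp add: Luk_def)
  then have Sn: "S ?n = ?n" by simp
  have mono: "S i \<le> S j" if "i \<le> j" "j \<le> ?n" for i j
    using that
  proof (induction rule: dec_induct)
    case (step k)
    then show ?case using Suc_S[of k] by simp
  qed simp
  have T: "output_times chi ?ps i = {t. t < ?n \<and> S i \<le> out ! t \<and> out ! t < S (Suc i)}" for i
    by (auto simp: output_times_def out_def S_def)
  have find: "\<exists>i<k. S i \<le> b \<and> b < S (Suc i)" if "b < S k" "k \<le> ?n" for b k
    using that
  proof (induction k)
    case (Suc k)
    show ?case
    proof (cases "b < S k")
      case True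
      then obtain i where "i < k" "S i \<le> b" "b < S (Suc i)"
        using Suc.IH Suc.prems(2) by (meson Suc_leD)
      then show ?thesis using less_SucI by blast
    next
      case False
      then show ?thesis using Suc.prems(1) by (intro exI[of _ k]) simp
    qed
  qed (simp add: S0)
  show ?thesis
  proof (rule partition_onI)
    show "\<Union> (output_partition chi js) = {..<?n}"
    proof (intro equalityI subsetI)
      fix t assume "t \<in> {..<?n}"
      then have t: "t < ?n" by simp
      then have "out ! t < S ?n" using set_out len_out Sn nth_mem[of t out] by auto
      from find[OF this order_refl] obtain i where i: "i < ?n" "S i \<le> out ! t" "out ! t < S (Suc i)"
        by auto
      then have "?ps ! i > 0" using Suc_S[of i] by auto
      then show "t \<in> \<Union> (output_partition chi js)"
        unfolding output_partition_def using i t T[of i] by auto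
    next
      fix t assume "t \<in> \<Union> (output_partition chi js)"
      then show "t \<in> {..<?n}" unfolding output_partition_def T by blast
    qed
  next
    fix P Q assume "P \<in> output_partition chi js" "Q \<in> output_partition chi js" "P \<noteq> Q"
    then obtain i j where ij: "P = output_times chi ?ps i" "Q = output_times chi ?ps j"
      "i < ?n" "j < ?n" "i \<noteq> j"
      unfolding output_partition_def by blast
    show "disjnt P Q"
    proof (cases "i < j")
      case True
      then have "S (Suc i) \<le> S j" using ij by (intro mono) auto
      then show ?thesis by (auto simp: ij T disjnt_iff)
    next
      case False
      then have "S (Suc j) \<le> S i" using ij by (intro mono) auto
      then show ?thesis by (auto simp: ij T disjnt_iff)
    qed
  next
    have "output_times chi ?ps i \<noteq> {}" if "i < ?n" "?ps ! i > 0" for i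
    proof -
      have "S i < ?n" using Suc_S[of i] mono[of "Suc i" ?n] that Sn by simp
      then obtain t where "t < ?n" "out ! t = S i"
        using set_out len_out by (metis in_set_conv_nth lessThan_iff)
      then have "t \<in> output_times chi ?ps i" using Suc_S[of i] that by (simp add: T)
      then show ?thesis by blast
    qed
    then show "{} \<notin> output_partition chi js" unfolding output_partition_def by blast
  qed
qed

lemma partition_on_lr_partitions: "\<pi> \<in> lr_partitions chi \<Longrightarrow> partition_on {..<length chi} \<pi>"
  by (auto simp: lr_partitions_def partition_on_output_partition)

lemma finite_lr_partitions: "finite (lr_partitions chi)"
proof (rule finite_subset)
  show "lr_partitions chi \<subseteq> Pow (Pow {..<length chi})"
    using partition_on_lr_partitions by (fastforce dest: partition_onD1)
qed auto

lemma one_block_in_lr_partitions: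
  assumes "chi \<noteq> []"
  shows "{{..<length chi}} \<in> lr_partitions chi"
proof -
  let ?n = "length chi"
  define js where "js = 0 # map (\<lambda>m. int (?n - Suc m)) [0..<?n]"
  have n: "?n > 0" using assms by simp
  have js_Suc: "js ! Suc m = int (?n - Suc m)" if "m < ?n" for m
    using that by (simp add: js_def)
  have js: "js \<in> Luk ?n"
    unfolding Luk_def
  proof (intro CollectI conjI allI impI)
    show "length js = Suc ?n" "js ! 0 = 0" by (simp_all add: js_def)
    show "js ! ?n = 0" using js_Suc[of "?n - 1"] n by simp
    show "0 \<le> js ! m" if "m \<le> ?n" for m
      using that js_Suc[of "m - 1"] by (cases m) (auto simp: js_def)
    show "- 1 \<le> js ! Suc m - js ! m" if "m < ?n" for m
      using that js_Suc[of "m - 1"] js_Suc[of m] by (cases m) (auto simp: js_def)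
  qed
  have zero: "insertions js ! i = 0" if "0 < i" "i < ?n" for i
    using that js_Suc[of i] js_Suc[of "i - 1"] by (simp add: insertions_def js_def)
  have pos: "insertions js ! 0 > 0"
    using n js_Suc[of 0] by (simp add: insertions_def js_def)
  have "output_partition chi js = {output_times chi (insertions js) 0}"
  proof -
    have "i < ?n \<and> insertions js ! i > 0 \<longleftrightarrow> i = 0" for i
      using zero[of i] pos n by (cases "i = 0") auto
    then show ?thesis unfolding output_partition_def by auto
  qed
  moreover from this have "output_times chi (insertions js) 0 = {..<?n}"
    using partition_on_output_partition[OF js] by (auto dest: partition_onD1)
  ultimately show ?thesis
    using js unfolding lr_partitions_def by (metis imageI)
qed

lemma proper_block:
  assumes \<pi>: "\<pi> \<in> lr_partitions chi" "\<pi> \<noteq> {{..<length chi}}" and V: "V \<in> \<pi>"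
  shows "length (nths chi V) < length chi" "nths chi V \<noteq> []"
proof -
  have p: "partition_on {..<length chi} \<pi>" by (rule partition_on_lr_partitions[OF \<pi>(1)])
  have sub: "V \<subseteq> {..<length chi}" using p V unfolding partition_on_def by blast
  have "V \<noteq> {..<length chi}"
  proof
    assume eq: "V = {..<length chi}"
    have "W = V" if "W \<in> \<pi>" for W
    proof (rule ccontr)
      assume "W \<noteq> V"
      then have "W \<inter> V = {}" using p that V unfolding partition_on_def disjoint_def by blast
      moreover have "W \<subseteq> V" "W \<noteq> {}" using p that eq unfolding partition_on_def by blast+
      ultimately show False by auto
    qed
    then have "\<pi> = {V}" using V by blast
    then show False using \<pi>(2) eq by simp
  qed
  then have "V \<subset> {..<length chi}" using sub by auto
  then have "card V < length chi" using psubset_card_mono[of "{..<length chi}" V] by simp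
  moreover have len: "length (nths chi V) = card V"
  proof -
    have "{i. i < length chi \<and> i \<in> V} = V" using sub by auto
    then show ?thesis by (simp add: length_nths)
  qed
  ultimately show "length (nths chi V) < length chi" by simp
  have "V \<noteq> {}" using p V by (auto simp: partition_on_def)
  then have "card V > 0" using sub finite_subset[OF sub] by (simp add: card_gt_0_iff)
  then show "nths chi V \<noteq> []" using len by auto
qed

lemma length_nths_cong: "length xs = length ys \<Longrightarrow> length (nths xs V) = length (nths ys V)"
  by (simp add: length_nths)

lemma nths_update:
  "i < length as \<Longrightarrow> nths (as[i := x]) V =
     (if i \<in> V then (nths as V)[card {k \<in> V. k < i} := x] else nths as V)"
proof (induction as arbitrary: i V)
  case (Cons a as)
  show ?case
  proof (cases i)
    case (Suc j)
    have "{k \<in> V. k < Suc j} = (if 0 \<in> V then {0} else {}) \<union> Suc ` {k. Suc k \<in> V \<and> k < j}"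
      by (auto simp: image_iff gr0_conv_Suc less_Suc_eq_0_disj)
    then have "card {k \<in> V. k < Suc j} = (if 0 \<in> V then Suc else id) (card {k. Suc k \<in> V \<and> k < j})"
      by (simp add: card_image)
    then show ?thesis using Cons.IH[of j "{j. Suc j \<in> V}"] Cons.prems Suc
      by (auto simp: nths_Cons)
  qed (auto simp: nths_Cons)
qed simp

lemma sum_lr_partitions_split:
  fixes \<kappa> :: "side list \<Rightarrow> 'a list \<Rightarrow> complex"
  assumes "chi \<noteq> []" "length as = length chi"
  shows "(\<Sum>\<pi>\<in>lr_partitions chi. \<Prod>V\<in>\<pi>. \<kappa> (nths chi V) (nths as V)) = \<kappa> chi as +
    (\<Sum>\<pi>\<in>lr_partitions chi - {{{..<length chi}}}. \<Prod>V\<in>\<pi>. \<kappa> (nths chi V) (nths as V))"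
  using assms
  by (subst sum.remove[OF finite_lr_partitions one_block_in_lr_partitions]) auto

theorem lr_cumulants_unique:
  assumes "lr_cumulants sc \<phi> \<kappa>" "lr_cumulants sc \<phi> \<kappa>'" "chi \<noteq> []" "length as = length chi"
  shows "\<kappa> chi as = \<kappa>' chi as"
  using assms(3,4)
proof (induction "length chi" arbitrary: chi as rule: less_induct)
  case less
  have "(\<Sum>\<pi>\<in>lr_partitions chi - {{{..<length chi}}}. \<Prod>V\<in>\<pi>. \<kappa> (nths chi V) (nths as V)) =
      (\<Sum>\<pi>\<in>lr_partitions chi - {{{..<length chi}}}. \<Prod>V\<in>\<pi>. \<kappa>' (nths chi V) (nths as V))"
  proof (rule sum.cong[OF refl], rule prod.cong[OF refl])
    fix \<pi> V assume "\<pi> \<in> lr_partitions chi - {{{..<length chi}}}" and V: "V \<in> \<pi>"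
    then have \<pi>: "\<pi> \<in> lr_partitions chi" "\<pi> \<noteq> {{..<length chi}}" by auto
    show "\<kappa> (nths chi V) (nths as V) = \<kappa>' (nths chi V) (nths as V)"
      by (rule less.hyps[OF proper_block[OF \<pi> V] length_nths_cong[OF less.prems(2)]])
  qed
  moreover have "(\<Sum>\<pi>\<in>lr_partitions chi. \<Prod>V\<in>\<pi>. \<kappa> (nths chi V) (nths as V)) =
      (\<Sum>\<pi>\<in>lr_partitions chi. \<Prod>V\<in>\<pi>. \<kappa>' (nths chi V) (nths as V))"
    using assms(1,2) less.prems unfolding lr_cumulants_def by metis
  ultimately show ?case using less.prems by (simp add: sum_lr_partitions_split)
qed

text \<open>
  The moment-cumulant formula solved for the term of the one-block partition. The guard is only
  needed for termination: the blocks of the other partitions are proper.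
\<close>

function cumulant_rec :: "('a :: ring_1 \<Rightarrow> complex) \<Rightarrow> side list \<Rightarrow> 'a list \<Rightarrow> complex" where
  "cumulant_rec \<phi> chi as = \<phi> (prod_list as) -
     (\<Sum>\<pi>\<in>lr_partitions chi - {{{..<length chi}}}. \<Prod>V\<in>\<pi>.
        if length (nths chi V) < length chi then cumulant_rec \<phi> (nths chi V) (nths as V) else 0)"
  by auto
termination by (relation "Wellfounded.measure (\<lambda>(\<phi>, chi, as). length chi)") auto

declare cumulant_rec.simps [simp del]

lemma cumulant_rec_eq:
  "cumulant_rec \<phi> chi as = \<phi> (prod_list as) -
     (\<Sum>\<pi>\<in>lr_partitions chi - {{{..<length chi}}}. \<Prod>V\<in>\<pi>. cumulant_rec \<phi> (nths chi V) (nths as V))"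
proof -
  have *: "(\<Prod>V\<in>\<pi>. if length (nths chi V) < length chi then cumulant_rec \<phi> (nths chi V) (nths as V) else 0) =
      (\<Prod>V\<in>\<pi>. cumulant_rec \<phi> (nths chi V) (nths as V))"
    if "\<pi> \<in> lr_partitions chi - {{{..<length chi}}}" for \<pi>
  proof (rule prod.cong[OF refl])
    fix V assume "V \<in> \<pi>"
    then have "length (nths chi V) < length chi" using that proper_block(1)[of \<pi> chi V] by blast
    then show "(if length (nths chi V) < length chi then cumulant_rec \<phi> (nths chi V) (nths as V) else 0) =
      cumulant_rec \<phi> (nths chi V) (nths as V)" by simp
  qed
  show ?thesis
    by (subst cumulant_rec.simps) (simp only: sum.cong[OF refl *])
qed

context nc_probability_space
begin

lemmas functional_iff = linear_functional_iff[OF vector_space_axioms]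

lemma linear_cumulant_rec:
  assumes "length as = length chi" "i < length chi"
  shows "Vector_Spaces.linear scale (*) (\<lambda>x. cumulant_rec \<phi> chi (as[i := x]))"
  using assms
proof (induction "length chi" arbitrary: chi as i rule: less_induct)
  case less
  have state: "\<phi> (x + y) = \<phi> x + \<phi> y" "\<phi> (scale c x) = c * \<phi> x" for x y c
    using linear_state unfolding functional_iff by blast+
  have "prod_list (as[i := x]) = prod_list (take i as) * x * prod_list (drop (Suc i) as)" for x
    using less.prems by (simp add: upd_conv_take_nth_drop mult.assoc)
  then have first: "\<phi> (prod_list (as[i := x + y])) = \<phi> (prod_list (as[i := x])) + \<phi> (prod_list (as[i := y]))"
    "\<phi> (prod_list (as[i := scale c x])) = c * \<phi> (prod_list (as[i := x]))" for x y c
    by (simp_all add: distrib_left distrib_right state flip: scale_mult_left scale_mult_right)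
  define F where "F \<pi> x = (\<Prod>V\<in>\<pi>. cumulant_rec \<phi> (nths chi V) (nths (as[i := x]) V))" for \<pi> x
  have F: "F \<pi> (x + y) = F \<pi> x + F \<pi> y \<and> F \<pi> (scale c x) = c * F \<pi> x"
    if \<pi>: "\<pi> \<in> lr_partitions chi - {{{..<length chi}}}" for \<pi> x y c
  proof -
    have p: "partition_on {..<length chi} \<pi>" using \<pi> partition_on_lr_partitions by blast
    obtain V where V: "V \<in> \<pi>" "i \<in> V"
      using p less.prems by (auto simp: partition_on_def)
    have fin: "finite \<pi>" using p by (metis finite_elements finite_lessThan)
    define j where "j = card {k \<in> V. k < i}"
    have other: "i \<notin> W" if "W \<in> \<pi> - {V}" for W
      using p that V unfolding partition_on_def disjoint_def by blast
    have eq: "F \<pi> x = cumulant_rec \<phi> (nths chi V) ((nths as V)[j := x]) *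
        (\<Prod>W\<in>\<pi> - {V}. cumulant_rec \<phi> (nths chi W) (nths as W))" for x
      unfolding F_def using V other less.prems
      by (subst prod.remove[OF fin V(1)]) (auto simp: nths_update j_def intro!: prod.cong)
    have "length (nths chi V) < length chi" using \<pi> V proper_block(1)[of \<pi> chi V] by blast
    moreover have "j < length (nths chi V)"
      unfolding j_def length_nths using V less.prems by (intro psubset_card_mono) auto
    ultimately have "Vector_Spaces.linear scale (*) (\<lambda>x. cumulant_rec \<phi> (nths chi V) ((nths as V)[j := x]))"
      using less.prems by (intro less.hyps length_nths_cong)
    then show ?thesis
      unfolding eq functional_iff by (simp add: distrib_right mult.assoc)
  qed
  have "cumulant_rec \<phi> chi (as[i := x]) = \<phi> (prod_list (as[i := x])) -
      (\<Sum>\<pi>\<in>lr_partitions chi - {{{..<length chi}}}. F \<pi> x)" for x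
    unfolding F_def by (rule cumulant_rec_eq)
  then show ?case
    unfolding functional_iff
    by (simp add: first F sum.distrib sum_distrib_left right_diff_distrib)
qed

theorem lr_cumulants_exist: "lr_cumulants scale \<phi> (cumulant_rec \<phi>)"
proof -
  have "\<phi> (prod_list as) =
      (\<Sum>\<pi>\<in>lr_partitions chi. \<Prod>V\<in>\<pi>. cumulant_rec \<phi> (nths chi V) (nths as V))"
    if "chi \<noteq> []" "length as = length chi" for chi and as :: "'a list"
    using cumulant_rec_eq[of \<phi> chi as] sum_lr_partitions_split[OF that, of "cumulant_rec \<phi>"]
    by algebra
  then show ?thesis
    unfolding lr_cumulants_def multilinear_def using linear_cumulant_rec by blast
qed

end

end

(* Running the deque process backwards in time, with every ball named by its output time, the deque
   before a move is the deque after it with the output time of the move put back at the side of the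
   move, minus the block of newly inserted balls at that end. In this form the reachable partitions
   are exactly those that are noncrossing with respect to the order
   "left output times increasing, then right output times decreasing" (deque_partitions_iff).

   The canonical operators act on basis vectors by such moves: C_n, ..., C_1 are applied in turn, each
   inserts a word, weighted by its coefficient, and removes one prescribed letter. So the vacuum
   moment is a sum over the deque partitions of the reversed side word. Reversing time turns the above
   order into a rotation of its reverse, and noncrossing is invariant under both; hence the sum can be
   read as one over the partitions of the original side word, with every block contributing the
   claimed cumulant. Uniqueness of the cumulants finishes the proof. *)

theory Submission
  imports Defs "HOL-Library.Sublist"
begin

section \<open>Noncrossing partitions generated by a deque\<close>

lemma subseq_rev: "subseq xs ys \<Longrightarrow> subseq (rev xs) (rev ys)"
  by (induction rule: list_emb.induct) (auto intro: list_emb_append_mono)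

lemma subseq_rev_iff: "subseq (rev xs) ys \<longleftrightarrow> subseq xs (rev ys)"
  by (metis rev_rev_ident subseq_rev)

text \<open>The order of a sublist is forced by the ambient distinct list, so a sublist can be
  recovered from its set of entries. This lets blocks be kept as sets while their words are still
  available.\<close>

lemma filter_subseq_distinct: "subseq xs ys \<Longrightarrow> distinct ys \<Longrightarrow> filter (\<lambda>y. y \<in> set xs) ys = xs"
proof (induction rule: list_emb.induct)
  case (list_emb_Cons xs ys y)
  then show ?case by (auto dest: list_emb_set)
next
  case (list_emb_Cons2 x y xs ys)
  have "filter (\<lambda>z. z \<in> set (x # xs)) ys = filter (\<lambda>z. z \<in> set xs) ys"
    using list_emb_Cons2 by (intro filter_cong) auto
  then show ?case using list_emb_Cons2 by simp
qed simp

lemma subseq_subset: "subseq xs ys \<Longrightarrow> set xs \<subseteq> set ys"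
  by (auto dest: list_emb_set)

text \<open>Applied with the new block as \<open>P\<close> and the remaining balls as
  \<open>Q\<close>, this shows that the block is an end segment of the deque.\<close>

lemma filter_disj_split:
  assumes "\<And>a b. subseq [a, b] xs \<Longrightarrow> Q a \<Longrightarrow> \<not> P b" "\<And>a. P a \<Longrightarrow> \<not> Q a"
  shows "filter (\<lambda>x. P x \<or> Q x) xs = filter P xs @ filter Q xs"
  using assms(1)
proof (induction xs)
  case (Cons x xs)
  have IH: "filter (\<lambda>x. P x \<or> Q x) xs = filter P xs @ filter Q xs"
    by (rule Cons.IH) (use Cons.prems in \<open>meson list_emb_Cons\<close>)
  show ?case
  proof (cases "Q x")
    case True
    then have "filter P xs = []"
      using Cons.prems[of x] by (auto simp: filter_empty_conv subseq_singleton_left)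
    then show ?thesis using True IH assms(2)[of x] by auto
  qed (simp add: IH)
qed simp

text \<open>
  The elements of \<open>S\<close> behave as one more block that also contains a point beyond both ends
  of \<open>xs\<close>, so no block may surround any of them.
\<close>

definition noncrossing :: "'a list \<Rightarrow> 'a set \<Rightarrow> 'a set set \<Rightarrow> bool" where
  "noncrossing xs S \<pi> \<longleftrightarrow>
     (\<forall>V\<in>\<pi>. \<forall>b c d. subseq [b, c, d] xs \<longrightarrow> b \<in> V \<longrightarrow> d \<in> V \<longrightarrow> c \<notin> S) \<and>
     (\<forall>V\<in>\<pi>. \<forall>W\<in>\<pi>. V \<noteq> W \<longrightarrow>
        (\<forall>a b c d. subseq [a, b, c, d] xs \<longrightarrow> a \<in> V \<longrightarrow> b \<in> W \<longrightarrow> c \<in> V \<longrightarrow> d \<notin> W))"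

lemma noncrossing_spanD:
  "noncrossing xs S \<pi> \<Longrightarrow> V \<in> \<pi> \<Longrightarrow> subseq [b, c, d] xs \<Longrightarrow> b \<in> V \<Longrightarrow> d \<in> V \<Longrightarrow> c \<in> S \<Longrightarrow> False"
  unfolding noncrossing_def by blast

lemma noncrossing_crossD:
  "noncrossing xs S \<pi> \<Longrightarrow> V \<in> \<pi> \<Longrightarrow> W \<in> \<pi> \<Longrightarrow> V \<noteq> W \<Longrightarrow> subseq [a, b, c, d] xs \<Longrightarrow>
    a \<in> V \<Longrightarrow> b \<in> W \<Longrightarrow> c \<in> V \<Longrightarrow> d \<in> W \<Longrightarrow> False"
  unfolding noncrossing_def by blast

lemma noncrossingI:
  assumes "\<And>V b c d. V \<in> \<pi> \<Longrightarrow> subseq [b, c, d] xs \<Longrightarrow> b \<in> V \<Longrightarrow> d \<in> V \<Longrightarrow> c \<in> S \<Longrightarrow> False"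
    and "\<And>V W a b c d. V \<in> \<pi> \<Longrightarrow> W \<in> \<pi> \<Longrightarrow> V \<noteq> W \<Longrightarrow> subseq [a, b, c, d] xs \<Longrightarrow>
      a \<in> V \<Longrightarrow> b \<in> W \<Longrightarrow> c \<in> V \<Longrightarrow> d \<in> W \<Longrightarrow> False"
  shows "noncrossing xs S \<pi>"
  unfolding noncrossing_def using assms by blast

section \<open>Symmetries of noncrossing families\<close>

lemma noncrossing_rev: "noncrossing xs S \<pi> \<Longrightarrow> noncrossing (rev xs) S \<pi>"
proof (rule noncrossingI)
  assume *: "noncrossing xs S \<pi>"
  show False if "V \<in> \<pi>" "subseq [b, c, d] (rev xs)" "b \<in> V" "d \<in> V" "c \<in> S" for V b c d
    using noncrossing_spanD[OF * that(1), of d c b] that subseq_rev_iff[of "[b, c, d]" xs] by simp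
  show False if "V \<in> \<pi>" "W \<in> \<pi>" "V \<noteq> W" "subseq [a, b, c, d] (rev xs)"
    "a \<in> V" "b \<in> W" "c \<in> V" "d \<in> W" for V W a b c d
    using noncrossing_crossD[OF * that(2,1), of d c b a] that subseq_rev_iff[of "[a, b, c, d]" xs] by simp
qed

lemma noncrossing_rev_iff [simp]: "noncrossing (rev xs) S \<pi> \<longleftrightarrow> noncrossing xs S \<pi>"
  using noncrossing_rev[of xs S \<pi>] noncrossing_rev[of "rev xs" S \<pi>] by auto

text \<open>A new crossing could only use \<open>x\<close> as its last point; moving
  \<open>x\<close> back to the front turns \<open>a, b, c, x\<close> into \<open>x, a, b, c\<close>,
  a crossing with the two blocks exchanged. With \<open>S\<close> empty, crossings are all that must
  be excluded; the condition on \<open>S\<close> refers to the ends of the list and has no cyclic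
  symmetry.\<close>

lemma noncrossing_rotate1:
  assumes "noncrossing (x # xs) {} \<pi>"
  shows "noncrossing (xs @ [x]) {} \<pi>"
proof (rule noncrossingI)
  fix V W a b c d
  assume VW: "V \<in> \<pi>" "W \<in> \<pi>" "V \<noteq> W" and mem: "a \<in> V" "b \<in> W" "c \<in> V" "d \<in> W"
    and "subseq [a, b, c, d] (xs @ [x])"
  \<comment> \<open>Reversing brings the appended \<open>x\<close> to the head, where the recursion
    equations of \<open>subseq\<close> apply.\<close>
  then have "subseq [d, c, b, a] (x # rev xs)"
    using subseq_rev[of "[a, b, c, d]" "xs @ [x]"] by simp
  then have "subseq [d, c, b, a] (rev xs) \<or> d = x \<and> subseq [c, b, a] (rev xs)"
    by (simp split: if_splits)
  then consider "subseq [a, b, c, d] xs" | "subseq [a, b, c] xs" "d = x"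
    using subseq_rev[of "[d, c, b, a]" "rev xs"] subseq_rev[of "[c, b, a]" "rev xs"] by auto
  then show False
  proof cases
    case 1
    then show False
      using noncrossing_crossD[OF assms VW list_emb_Cons, of a b c d] mem by blast
  next
    case 2
    then show False using noncrossing_crossD[OF assms VW(2,1), of x a b c] VW mem by auto
  qed
qed simp

lemma noncrossing_rotate: "noncrossing (xs @ ys) {} \<pi> \<Longrightarrow> noncrossing (ys @ xs) {} \<pi>"
proof (induction xs arbitrary: ys)
  case (Cons x xs)
  then show ?case using Cons.IH[of "ys @ [x]"] noncrossing_rotate1[of x "xs @ ys"] by simp
qed simp

section \<open>One backward move of the deque\<close>

definition add_block :: "'a list \<Rightarrow> 'a set set \<Rightarrow> 'a set set" where
  "add_block B \<pi> = (if B = [] then \<pi> else insert (set B) \<pi>)"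

text \<open>Here \<open>xs\<close> lists the output times still to come, in left-to-right order, and
  \<open>D\<close> the balls already in the deque. The blocks of \<open>\<pi>\<close> enter later,
  each at one end, and so cannot enclose a ball of \<open>D\<close>.\<close>

definition admissible :: "'a list \<Rightarrow> 'a list \<Rightarrow> 'a set set \<Rightarrow> bool" where
  "admissible xs D \<pi> \<longleftrightarrow> subseq D xs \<and> partition_on (set xs - set D) \<pi> \<and> noncrossing xs (set D) \<pi>"

text \<open>In \<open>x # D'\<close> the block \<open>B\<close> precedes \<open>D\<close>, hence
  encloses no ball of \<open>D\<close>. If it crossed a block of \<open>\<pi>'\<close>, that block
  would enclose a ball of \<open>D'\<close>, which the condition on \<open>set D'\<close>
  forbids.\<close>

lemma admissible_ConsI:
  assumes xs: "distinct (x # xs)" and adm: "admissible xs D' \<pi>'" and eq: "x # D' = B @ D"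
  shows "admissible (x # xs) D (add_block B \<pi>')"
proof -
  have D': "subseq D' xs" and p: "partition_on (set xs - set D') \<pi>'" and nc: "noncrossing xs (set D') \<pi>'"
    using adm unfolding admissible_def by auto
  have U: "\<Union>\<pi>' = set xs - set D'" using p by (simp add: partition_on_def)
  have dD': "distinct D'" using D' xs by (metis distinct.simps(2) filter_subseq_distinct distinct_filter)
  show ?thesis
  proof (cases B)
    case Nil
    then have D: "D = x # D'" using eq by simp
    have "noncrossing (x # xs) (set D) \<pi>'"
    proof (rule noncrossingI)
      fix V b c d assume "V \<in> \<pi>'" "subseq [b, c, d] (x # xs)" "b \<in> V" "d \<in> V" "c \<in> set D"
      moreover from this have "b \<noteq> x" using U xs by auto
      moreover have "c \<noteq> x" using calculation xs by (auto dest: subseq_subset)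
      ultimately show False using noncrossing_spanD[OF nc, of V b c d] D by auto
    next
      fix V W a b c d assume "V \<in> \<pi>'" "W \<in> \<pi>'" "V \<noteq> W" "subseq [a, b, c, d] (x # xs)" "a \<in> V" "b \<in> W" "c \<in> V" "d \<in> W"
      moreover from this have "a \<noteq> x" using U xs by auto
      ultimately show False using noncrossing_crossD[OF nc, of V W a b c d] by auto
    qed
    moreover have "set (x # xs) - set D = set xs - set D'" using D xs by auto
    ultimately show ?thesis using D D' p Nil by (auto simp: admissible_def add_block_def)
  next
    case (Cons y u)
    then have B: "B = x # u" and D'_eq: "D' = u @ D" using eq by auto
    let ?V = "insert x (set u)"
    have "x \<notin> set D'" using D' xs by (auto dest: subseq_subset)
    have disj: "V \<inter> ?V = {}" if "V \<in> \<pi>'" for V using U that D'_eq xs by auto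
    have sub: "set D' \<subseteq> set xs" using D' by (rule subseq_subset)
    have "partition_on (set (x # xs) - set D) (insert ?V \<pi>')"
    proof -
      have "set (x # xs) - set D = (set xs - set D') \<union> ?V"
        using D'_eq dD' sub \<open>x \<notin> set D'\<close> by auto
      then show ?thesis using p disj sub
        by (auto simp: partition_on_def disjoint_def)
    qed
    moreover have "subseq D (x # xs)"
      using D' unfolding D'_eq by (blast intro: list_emb_Cons dest: list_emb_appendD subseq_order.order_trans[OF subseq_drop_many[OF subseq_order.refl]])
    moreover have "noncrossing (x # xs) (set D) (insert ?V \<pi>')"
    proof (rule noncrossingI)
      fix V b c d assume V: "V \<in> insert ?V \<pi>'" and s: "subseq [b, c, d] (x # xs)" and mem: "b \<in> V" "d \<in> V" "c \<in> set D"
      have s': "subseq [c, d] xs" using s by (auto split: if_splits dest: subseq_Cons')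
      show False
      proof (cases "V = ?V")
        case True
        have "d \<noteq> x" using s' xs by (auto dest: subseq_subset)
        then have "d \<in> set u" using mem True by auto
        \<comment> \<open>Both points are balls of \<open>D'\<close>, so \<open>[c, d]\<close> is a
          sublist of \<open>u @ D\<close>; but \<open>c\<close> lies in \<open>D\<close> and
          \<open>d\<close> in \<open>u\<close>, which is the opposite order.\<close>
        have "filter (\<lambda>y. y \<in> set D') [c, d] = [c, d]" using mem \<open>d \<in> set u\<close> D'_eq by auto
        then have "subseq [c, d] D'"
          using subseq_filter[OF s', of "\<lambda>y. y \<in> set D'"] filter_subseq_distinct[OF D'] xs by simp
        then obtain p q where "[c, d] = p @ q" "subseq p u" "subseq q D"
          unfolding D'_eq by (rule subseq_appendE) 
        then show False using mem \<open>d \<in> set u\<close> dD' D'_eq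
          by (cases p; cases q) (auto simp: Cons_eq_append_conv dest!: subseq_subset)
      next
        case False
        then have "V \<in> \<pi>'" using V by auto
        moreover from this have "b \<noteq> x" using mem disj by auto
        ultimately show False using noncrossing_spanD[OF nc, of V b c d] s mem D'_eq by auto
      qed
    next
      fix V W a b c d assume VW: "V \<in> insert ?V \<pi>'" "W \<in> insert ?V \<pi>'" "V \<noteq> W" and s: "subseq [a, b, c, d] (x # xs)"
        and mem: "a \<in> V" "b \<in> W" "c \<in> V" "d \<in> W"
      have s': "subseq [b, c, d] xs" using s by (auto split: if_splits dest: subseq_Cons')
      then have nx: "b \<noteq> x" "c \<noteq> x" "d \<noteq> x" using xs by (auto dest: subseq_subset)
      consider "V = ?V" "W \<in> \<pi>'" | "W = ?V" "V \<in> \<pi>'" | "V \<in> \<pi>'" "W \<in> \<pi>'" using VW by auto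
      then show False
      proof cases
        case 1
        then show False using noncrossing_spanD[OF nc, of W b c d] s' mem nx D'_eq by auto
      next
        case 2
        then have "a \<noteq> x" using mem disj by auto
        then have "subseq [a, b, c, d] xs" using s by simp
        then have "subseq [a, b, c] xs"
          using subseq_order.order_trans[of "[a, b, c]" "[a, b, c, d]"] by (simp add: prefix_imp_subseq)
        then show False using noncrossing_spanD[OF nc, of V a b c] 2 mem nx D'_eq by auto
      next
        case 3
        then have "a \<noteq> x" using mem disj by auto
        then show False using noncrossing_crossD[OF nc 3 VW(3), of a b c d] s mem by auto
      qed
    qed
    ultimately show ?thesis unfolding admissible_def add_block_def B by simp
  qed
qed

text \<open>If \<open>x\<close> is a ball of \<open>D\<close>, it heads \<open>D\<close> and the
  move inserted nothing. Otherwise the block of \<open>x\<close> is the one inserted by the move,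
  and undoing its separation returns its other balls to the deque.\<close>

lemma admissible_ConsD:
  assumes xs: "distinct (x # xs)" and adm: "admissible (x # xs) D \<pi>"
  shows "\<exists>D' \<pi>' B. admissible xs D' \<pi>' \<and> x # D' = B @ D \<and> \<pi> = add_block B \<pi>'"
proof -
  have D: "subseq D (x # xs)" and p: "partition_on (set (x # xs) - set D) \<pi>"
    and nc: "noncrossing (x # xs) (set D) \<pi>"
    using adm unfolding admissible_def by auto
  have dj: "V \<inter> W = {}" if "V \<in> \<pi>" "W \<in> \<pi>" "V \<noteq> W" for V W
    using p that by (auto simp: partition_on_def disjoint_def)
  have U: "\<Union>\<pi> = set (x # xs) - set D" and ne: "{} \<notin> \<pi>" using p by (auto simp: partition_on_def)
  show ?thesis
  proof (cases "x \<in> set D")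
    case True
    have "D = x # filter (\<lambda>y. y \<in> set D) xs"
      using filter_subseq_distinct[OF D xs] True by simp
    then obtain D' where DD': "D = x # D'" by blast
    then have "subseq D' xs" using D by simp
    moreover have "set (x # xs) - set D = set xs - set D'" using xs DD' by auto
    moreover have "noncrossing xs (set D') \<pi>"
    proof (rule noncrossingI)
      show False if "V \<in> \<pi>" "subseq [b, c, d] xs" "b \<in> V" "d \<in> V" "c \<in> set D'" for V b c d
        using noncrossing_spanD[OF nc that(1) list_emb_Cons, of b c d] that DD' by auto
      show False if "V \<in> \<pi>" "W \<in> \<pi>" "V \<noteq> W" "subseq [a, b, c, d] xs"
        "a \<in> V" "b \<in> W" "c \<in> V" "d \<in> W" for V W a b c d
        using noncrossing_crossD[OF nc that(1-3) list_emb_Cons, of a b c d] that by blast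
    qed
    ultimately have "admissible xs D' \<pi>" using p by (simp add: admissible_def)
    then show ?thesis using DD' by (intro exI[of _ D'] exI[of _ \<pi>] exI[of _ "[]"]) (simp add: add_block_def)
  next
    case False
    then obtain V where V: "V \<in> \<pi>" "x \<in> V" using U by auto
    \<comment> \<open>After the removal of \<open>x\<close> the deque consists of the old balls
      \<open>D\<close> and the rest of the block \<open>V\<close>.\<close>
    define D' where "D' = filter (\<lambda>y. y \<in> V \<or> y \<in> set D) xs"
    define u where "u = filter (\<lambda>y. y \<in> V) xs"
    have Dxs: "subseq D xs" using D False by (cases D) (auto split: if_splits)
    have VD: "V \<inter> set D = {}" "V \<subseteq> set (x # xs)" using U V by auto
    have "D' = u @ filter (\<lambda>y. y \<in> set D) xs"
      unfolding D'_def u_def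
    proof (rule filter_disj_split)
      fix a b assume "subseq [a, b] xs" "a \<in> set D"
      \<comment> \<open>The point \<open>x\<close> of \<open>V\<close> precedes all of
        \<open>xs\<close>, so \<open>V\<close> would enclose the ball \<open>a\<close> of
        \<open>D\<close>.\<close>
      then show "b \<notin> V" using noncrossing_spanD[OF nc V(1), of x a b] V by auto
    qed (use VD in auto)
    then have D'_eq: "D' = u @ D" using filter_subseq_distinct[OF Dxs] xs by simp
    have setV: "set (x # u) = V" using VD V unfolding u_def by auto
    have setD': "set D' = set u \<union> set D" using D'_eq by simp
    have "subseq D' xs" unfolding D'_def by simp
    moreover have "partition_on (set xs - set D') (\<pi> - {V})"
    proof -
      have "\<Union>(\<pi> - {V}) = \<Union>\<pi> - V" using dj V by blast
      also have "\<dots> = set xs - set D'" using U setV setD' xs by auto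
      finally show ?thesis using ne dj by (auto simp: partition_on_def disjoint_def)
    qed
    moreover have "noncrossing xs (set D') (\<pi> - {V})"
    proof (rule noncrossingI)
      fix W b c d assume W: "W \<in> \<pi> - {V}" and s: "subseq [b, c, d] xs" and mem: "b \<in> W" "d \<in> W" "c \<in> set D'"
      show False
      proof (cases "c \<in> set D")
        case True
        then show False using noncrossing_spanD[OF nc _ list_emb_Cons, of W b c d] W s mem by blast
      next
        case False
        \<comment> \<open>A block \<open>W\<close> around a point of \<open>V\<close> crosses
          \<open>V\<close>, the fourth point being \<open>x\<close> in front.\<close>
        then have "c \<in> V" using mem setD' setV by auto
        then show False using noncrossing_crossD[OF nc V(1), of W x b c d] W s mem V by auto
      qed
    next
      fix W W' a b c d assume "W \<in> \<pi> - {V}" "W' \<in> \<pi> - {V}" "W \<noteq> W'" "subseq [a, b, c, d] xs" "a \<in> W" "b \<in> W'" "c \<in> W" "d \<in> W'"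
      then show False using noncrossing_crossD[OF nc _ _ _ list_emb_Cons, of W W' a b c d] by blast
    qed
    ultimately have "admissible xs D' (\<pi> - {V})" by (simp add: admissible_def)
    moreover have "\<pi> = add_block (x # u) (\<pi> - {V})" using V setV by (auto simp: add_block_def)
    ultimately show ?thesis using D'_eq by (intro exI[of _ D'] exI[of _ "\<pi> - {V}"] exI[of _ "x # u"]) simp
  qed
qed

lemma admissible_rev [simp]: "admissible (rev xs) (rev D) \<pi> \<longleftrightarrow> admissible xs D \<pi>"
  by (simp add: admissible_def subseq_rev_iff)

fun join :: "side \<Rightarrow> 'a list \<Rightarrow> 'a list \<Rightarrow> 'a list" where
  "join Lside B D = B @ D"
| "join Rside B D = D @ B"

lemma admissible_join:
  assumes xs: "distinct (x # xs)"
  shows "admissible (join h [x] xs) D \<pi> \<longleftrightarrow>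
    (\<exists>D' \<pi>' B. admissible xs D' \<pi>' \<and> join h [x] D' = join h B D \<and> \<pi> = add_block B \<pi>')"
proof (cases h)
  case Lside
  then show ?thesis using admissible_ConsD[OF xs, of D \<pi>] admissible_ConsI[OF xs] by auto
next
  case Rside
  \<comment> \<open>Reversing the ambient list, the deques and the block reduces the right side to
    the left side.\<close>
  have rxs: "distinct (x # rev xs)" using xs by simp
  have "admissible (xs @ [x]) D \<pi> \<longleftrightarrow> admissible (x # rev xs) (rev D) \<pi>"
    using admissible_rev[of "xs @ [x]" D \<pi>] by simp
  also have "\<dots> \<longleftrightarrow> (\<exists>D' \<pi>' B. admissible (rev xs) D' \<pi>' \<and> x # D' = B @ rev D \<and> \<pi> = add_block B \<pi>')"
    using admissible_ConsD[OF rxs, of "rev D" \<pi>] admissible_ConsI[OF rxs] by auto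
  also have "\<dots> \<longleftrightarrow> (\<exists>D' \<pi>' B. admissible xs D' \<pi>' \<and> D' @ [x] = D @ B \<and> \<pi> = add_block B \<pi>')"
    (is "?l \<longleftrightarrow> ?r")
  proof
    assume ?l
    then obtain D' \<pi>' B where "admissible (rev xs) D' \<pi>'" "x # D' = B @ rev D" "\<pi> = add_block B \<pi>'"
      by blast
    moreover from this have "rev D' @ [x] = D @ rev B"
      by (metis rev.simps(2) rev_append rev_rev_ident)
    ultimately show ?r
      using admissible_rev[of xs "rev D'" \<pi>']
      by (intro exI[of _ "rev D'"] exI[of _ \<pi>'] exI[of _ "rev B"]) (simp add: add_block_def)
  next
    assume ?r
    then obtain D' \<pi>' B where "admissible xs D' \<pi>'" "D' @ [x] = D @ B" "\<pi> = add_block B \<pi>'"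
      by blast
    moreover from this have "x # rev D' = rev B @ rev D"
      by (metis rev_append rev_eq_Cons_iff rev_rev_ident)
    ultimately show ?l
      by (intro exI[of _ "rev D'"] exI[of _ \<pi>'] exI[of _ "rev B"]) (simp add: add_block_def)
  qed
  finally show ?thesis using Rside by simp
qed

text \<open>Each move puts its own output time outside all later ones, on its own side. Balls that
  are in the deque together therefore stand there in the order of their output times in this
  list.\<close>

fun exit_order :: "side list \<Rightarrow> nat \<Rightarrow> nat list" where
  "exit_order [] i = []"
| "exit_order (h # hs) i = join h [i] (exit_order hs (Suc i))"

text \<open>
  In a pair \<open>(D, \<pi>)\<close> the list \<open>D\<close> is the deque before move \<open>i\<close>, each ball
  represented by its output time, and \<open>\<pi>\<close> consists of the blocks inserted from move \<open>i\<close> on.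
  The block \<open>B\<close> inserted in the move ends with the ball removed by the same move.
\<close>

fun deque_partitions :: "side list \<Rightarrow> nat \<Rightarrow> (nat list \<times> nat set set) set" where
  "deque_partitions [] i = {([], {})}"
| "deque_partitions (h # hs) i =
     {(D, add_block B \<pi>) | D B D' \<pi>. (D', \<pi>) \<in> deque_partitions hs (Suc i) \<and> join h [i] D' = join h B D}"

lemma set_join [simp]: "set (join h B D) = set B \<union> set D"
  by (cases h) auto

lemma distinct_join [simp]: "distinct (join h B D) \<longleftrightarrow> distinct (B @ D)"
  by (cases h) auto

lemma set_exit_order: "set (exit_order hs i) = {i..<i + length hs}"
  by (induction hs arbitrary: i) auto

lemma distinct_exit_order: "distinct (exit_order hs i)"
  by (induction hs arbitrary: i) (auto simp: set_exit_order)

theorem deque_partitions_iff: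
  "(D, \<pi>) \<in> deque_partitions hs i \<longleftrightarrow> admissible (exit_order hs i) D \<pi>"
proof (induction hs arbitrary: i D \<pi>)
  case Nil
  show ?case by (auto simp: admissible_def noncrossing_def partition_on_empty)
next
  case (Cons h hs)
  have "distinct (i # exit_order hs (Suc i))"
    by (simp add: distinct_exit_order set_exit_order)
  from admissible_join[OF this] show ?case by (auto simp: Cons.IH)
qed

section \<open>Output-time partitions are noncrossing partitions\<close>

text \<open>Balls inserted one at a time at the left end finally stand in reversed order, at the
  right end in their original order.\<close>

fun orient :: "side \<Rightarrow> 'a list \<Rightarrow> 'a list" where
  "orient Lside xs = rev xs"
| "orient Rside xs = xs"

lemma set_orient [simp]: "set (orient h xs) = set xs"
  and length_orient [simp]: "length (orient h xs) = length xs"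
  and distinct_orient [simp]: "distinct (orient h xs) \<longleftrightarrow> distinct xs"
  and map_orient: "map f (orient h xs) = orient h (map f xs)"
  and orient_orient [simp]: "orient h (orient h xs) = xs"
  and orient_Nil_iff [simp]: "orient h xs = [] \<longleftrightarrow> xs = []"
  by (cases h; simp add: rev_map)+

lemma length_join [simp]: "length (join h B D) = length B + length D"
  and map_join: "map f (join h B D) = join h (map f B) (map f D)"
  and join_eq_iff: "length B = length B' \<or> length D = length D' \<Longrightarrow>
    join h B D = join h B' D' \<longleftrightarrow> B = B' \<and> D = D'"
  by (cases h; auto)+

lemma fold_insert_ball: "fold (insert_ball h) bs q = join h (orient h bs) q"
  by (induction bs arbitrary: q; cases h) auto

lemma join_end_ball: "q \<noteq> [] \<Longrightarrow> join h [end_ball h q] (remove_ball h q) = q"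
  by (cases h) auto

text \<open>The Lukasiewicz condition as a recursion on the moves: \<open>m\<close> is the current
  number of balls, no removal meets an empty deque, and the deque ends empty. An arbitrary starting
  size is what the inductions need.\<close>

fun feasible :: "nat \<Rightarrow> nat list \<Rightarrow> bool" where
  "feasible m [] \<longleftrightarrow> m = 0"
| "feasible m (p # ps) \<longleftrightarrow> m + p > 0 \<and> feasible (m + p - 1) ps"

fun label_blocks :: "nat list \<Rightarrow> nat \<Rightarrow> nat set set" where
  "label_blocks [] s = {}"
| "label_blocks (p # ps) s = add_block [s..<s + p] (label_blocks ps (s + p))"

fun first_index :: "'a list \<Rightarrow> 'a \<Rightarrow> nat" where
  "first_index [] b = 0"
| "first_index (x # xs) b = (if x = b then 0 else Suc (first_index xs b))"

abbreviation exit_time :: "side list \<Rightarrow> nat list \<Rightarrow> nat \<Rightarrow> nat list \<Rightarrow> nat \<Rightarrow> nat \<Rightarrow> nat" where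
  "exit_time hs ps s q i b \<equiv> i + first_index (outputs hs ps s q) b"

lemma label_blocks_ge: "V \<in> label_blocks ps s \<Longrightarrow> b \<in> V \<Longrightarrow> s \<le> b"
  by (induction ps arbitrary: s) (auto simp: add_block_def split: if_splits dest: add_leD1)

lemma add_block_map: "add_block (map f B) ((`) f ` \<pi>) = (`) f ` add_block B \<pi>"
  by (simp add: add_block_def)

text \<open>Only the removed ball has output time \<open>i\<close>; for all other balls the output
  times computed before and after the move agree. Renaming balls by output times therefore turns the
  forward move into the recursion of \<open>deque_partitions\<close>.\<close>

lemma exit_time_step:
  fixes h hs p ps s q i
  defines "\<tau> \<equiv> exit_time (h # hs) (p # ps) s q i"
    and "q' \<equiv> remove_ball h (join h (orient h [s..<s + p]) q)"
  defines "\<tau>' \<equiv> exit_time hs ps (s + p) q' (Suc i)"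
  assumes q: "0 < length q + p" "distinct q" "set q \<subseteq> {..<s}"
  shows "join h [i] (map \<tau>' q') = join h (map \<tau> (orient h [s..<s + p])) (map \<tau> q)"
    and "(`) \<tau> ` label_blocks (p # ps) s =
      add_block (map \<tau> (orient h [s..<s + p])) ((`) \<tau>' ` label_blocks ps (s + p))"
    and "length q' = length q + p - 1" "distinct q'" "set q' \<subseteq> {..<s + p}"
proof -
  define E where "E = join h (orient h [s..<s + p]) q"
  define e where "e = end_ball h E"
  have ne: "E \<noteq> []" using q(1) unfolding E_def by (metis length_join length_orient length_upt
    add_diff_cancel_left' add.commute length_greater_0_conv)
  have E: "join h [e] q' = E" unfolding e_def q'_def E_def[symmetric] by (rule join_end_ball[OF ne])
  have dE: "distinct E" using q(2,3) by (auto simp: E_def)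
  have setE: "set E \<subseteq> {..<s + p}" using q(3) by (auto simp: E_def)
  have "outputs (h # hs) (p # ps) s q = e # outputs hs ps (s + p) q'"
    by (simp add: fold_insert_ball e_def q'_def E_def Let_def)
  then have \<tau>: "\<tau> b = (if e = b then i else \<tau>' b)" for b
    unfolding \<tau>_def \<tau>'_def by simp
  have e: "e \<notin> set q'" "e < s + p" using dE setE unfolding E[symmetric] by auto
  have "join h [i] (map \<tau>' q') = map \<tau> (join h [e] q')"
    using e by (auto simp: map_join \<tau> intro!: arg_cong[of _ _ "join h [i]"])
  then show "join h [i] (map \<tau>' q') = join h (map \<tau> (orient h [s..<s + p])) (map \<tau> q)"
    unfolding E by (simp add: E_def map_join)
  \<comment> \<open>Labels used later are at least \<open>s + p\<close> and so differ from the ball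
    \<open>e\<close> removed now.\<close>
  have "\<tau> ` V = \<tau>' ` V" if "V \<in> label_blocks ps (s + p)" for V
    using label_blocks_ge[OF that] e(2) by (intro image_cong) (auto simp: \<tau> dest: leD)
  then have *: "(`) \<tau> ` label_blocks ps (s + p) = (`) \<tau>' ` label_blocks ps (s + p)"
    by (rule image_cong[OF refl])
  have **: "add_block (map \<tau> (orient h [s..<s + p])) X = add_block (map \<tau> [s..<s + p]) X" for X
    by (simp add: add_block_def)
  show "(`) \<tau> ` label_blocks (p # ps) s =
      add_block (map \<tau> (orient h [s..<s + p])) ((`) \<tau>' ` label_blocks ps (s + p))"
    by (simp only: label_blocks.simps add_block_map[symmetric] ** *)
  have "Suc (length q') = length E" unfolding E[symmetric] by simp
  then show "length q' = length q + p - 1" by (simp add: E_def)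
  show "distinct q'" "set q' \<subseteq> {..<s + p}"
    using dE setE unfolding E[symmetric] by auto
qed

lemma exit_times_in_deque_partitions:
  assumes "length hs = length ps" "feasible (length q) ps" "distinct q" "set q \<subseteq> {..<s}"
  shows "(map (exit_time hs ps s q i) q, (`) (exit_time hs ps s q i) ` label_blocks ps s)
    \<in> deque_partitions hs i"
  using assms
proof (induction hs ps arbitrary: q s i rule: list_induct2)
  case (Cons h hs p ps)
  have "0 < length q + p" using Cons.prems by simp
  note step = exit_time_step(1,2)[OF this Cons.prems(2,3), where h = h and hs = hs and ps = ps and i = i]
    exit_time_step(3-5)[OF this Cons.prems(2,3), where h = h]
  have "feasible (length q + p - 1) ps" using Cons.prems by simp
  then show ?case
    unfolding step(2) deque_partitions.simps
    using Cons.IH[of _ "s + p" "Suc i", OF _ step(4,5), unfolded step(3)] step(1) by blast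
qed simp

text \<open>The numbers \<open>ps\<close> are the lengths of the inserted blocks. Running backwards
  fixes them before any label is known, so the claim must hold for every labelling \<open>q\<close>
  of the balls present and every next label \<open>s\<close>.\<close>

lemma deque_partitions_exit_times:
  assumes "(D, \<pi>) \<in> deque_partitions hs i"
  shows "\<exists>ps. length hs = length ps \<and> feasible (length D) ps \<and>
    (\<forall>q s. length q = length D \<longrightarrow> distinct q \<longrightarrow> set q \<subseteq> {..<s} \<longrightarrow>
      D = map (exit_time hs ps s q i) q \<and> \<pi> = (`) (exit_time hs ps s q i) ` label_blocks ps s)"
  using assms
proof (induction hs arbitrary: D \<pi> i)
  case (Cons h hs)
  then obtain D' B \<pi>' where \<pi>: "\<pi> = add_block B \<pi>'" and D': "(D', \<pi>') \<in> deque_partitions hs (Suc i)"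
    and eq: "join h [i] D' = join h B D" by auto
  from Cons.IH[OF D'] obtain ps where ps: "length hs = length ps" "feasible (length D') ps"
    and IH: "\<And>q s. length q = length D' \<Longrightarrow> distinct q \<Longrightarrow> set q \<subseteq> {..<s} \<Longrightarrow>
      D' = map (exit_time hs ps s q (Suc i)) q \<and> \<pi>' = (`) (exit_time hs ps s q (Suc i)) ` label_blocks ps s"
    by blast
  define p where "p = length B"
  have len: "Suc (length D') = p + length D"
    using arg_cong[OF eq, of length] by (simp add: p_def)
  have feas: "feasible (length D) (p # ps)" using ps(2) len by (cases "p + length D") (auto simp: add.commute)
  have "D = map (exit_time (h # hs) (p # ps) s q i) q \<and>
      \<pi> = (`) (exit_time (h # hs) (p # ps) s q i) ` label_blocks (p # ps) s"
    if q: "length q = length D" "distinct q" "set q \<subseteq> {..<s}" for q s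
  proof -
    define \<tau> where "\<tau> = exit_time (h # hs) (p # ps) s q i"
    have "0 < length q + p" using len q(1) by linarith
    note step = exit_time_step(1,2)[OF this q(2,3), where h = h and hs = hs and ps = ps and i = i]
      exit_time_step(3-5)[OF this q(2,3), where h = h]
    have "length q + p - 1 = length D'" using len q(1) by simp
    note IH' = IH[OF step(3)[unfolded this] step(4,5)]
    have "join h B D = join h (map \<tau> (orient h [s..<s + p])) (map \<tau> q)"
      using step(1) eq IH' unfolding \<tau>_def by metis
    \<comment> \<open>Since \<open>D\<close> and \<open>q\<close> have equal length, the two
      splittings of the same list coincide.\<close>
    then have BD: "B = map \<tau> (orient h [s..<s + p])" "D = map \<tau> q"
      by (auto simp: join_eq_iff q(1))
    then show ?thesis using step(2) IH' unfolding \<pi> \<tau>_def by metis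
  qed
  then show ?case using feas ps(1) by (intro exI[of _ "p # ps"]) (simp del: outputs.simps label_blocks.simps)
qed auto

section \<open>Insertion sequences of Lukasiewicz paths\<close>

lemma feasible_iff:
  "feasible m ps \<longleftrightarrow> m + sum_list ps = length ps \<and> (\<forall>k<length ps. k < m + sum_list (take (Suc k) ps))"
proof (induction ps arbitrary: m)
  case (Cons p ps)
  show ?case
  proof (cases "m + p")
    case 0
    then show ?thesis by auto
  next
    case (Suc m')
    have "(\<forall>k<Suc (length ps). k < m + sum_list (take (Suc k) (p # ps))) \<longleftrightarrow>
        (\<forall>k<length ps. k < m' + sum_list (take (Suc k) ps))"
      using Suc unfolding All_less_Suc2 by (auto simp: add.assoc[symmetric])
    then show ?thesis using Suc by (simp add: Cons.IH add.assoc[symmetric])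
  qed
qed auto

lemma feasible_insertions:
  assumes "js \<in> Luk n"
  shows "feasible 0 (insertions js)"
proof -
  note len = length_insertions[OF assms]
  have "int (sum_list (insertions js)) = int n"
    using sum_insertions[OF assms order_refl] assms len by (simp add: Luk_def)
  moreover have "k < sum_list (take (Suc k) (insertions js))" if "k < n" for k
  proof -
    have "0 \<le> js ! Suc k" using assms that by (simp add: Luk_def)
    then show ?thesis using sum_insertions[OF assms, of "Suc k"] that by simp
  qed
  ultimately show ?thesis by (simp add: feasible_iff len)
qed

lemma insertions_surj:
  assumes "feasible 0 ps"
  obtains js where "js \<in> Luk (length ps)" "insertions js = ps"
proof
  let ?S = "\<lambda>k. sum_list (take k ps)"
  \<comment> \<open>The height after \<open>k\<close> moves is the size of the deque: balls inserted
    minus balls removed.\<close>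
  define js where "js = map (\<lambda>k. int (?S k) - int k) [0..<Suc (length ps)]"
  have nth: "js ! k = int (?S k) - int k" if "k \<le> length ps" for k
    using that unfolding js_def by (subst nth_map) (auto simp del: upt_Suc)
  have len: "length js = Suc (length ps)" by (simp add: js_def)
  have rise: "js ! Suc k - js ! k = int (ps ! k) - 1" if "k < length ps" for k
    using that by (simp add: nth take_Suc_conv_app_nth)
  have "0 \<le> js ! m" if "m \<le> length ps" for m
    using assms that unfolding feasible_iff nth[OF that] by (cases m) (auto simp: Suc_le_eq)
  then show "js \<in> Luk (length ps)"
    using assms by (auto simp: Luk_def len rise nth feasible_iff take_Suc_conv_app_nth)
  show "insertions js = ps"
    by (rule nth_equalityI) (auto simp: insertions_def len rise)
qed

lemma setcompr_nat_split:
  "{f j | j. P j} = (if P 0 then {f 0} else {}) \<union> {f (Suc j) | j. P (Suc j)}"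
proof -
  have "(\<exists>j. Q j) \<longleftrightarrow> Q 0 \<or> (\<exists>j. Q (Suc j))" for Q :: "nat \<Rightarrow> bool"
    by (metis not0_implies_Suc)
  from this[of "\<lambda>j. _ = f j \<and> P j"] show ?thesis by (simp add: set_eq_iff)
qed

lemma label_blocks_eq:
  "label_blocks ps s = {{s + sum_list (take j ps)..<s + sum_list (take (Suc j) ps)} | j. j < length ps \<and> ps ! j > 0}"
proof (induction ps arbitrary: s)
  case (Cons p ps)
  show ?case
    by (subst setcompr_nat_split) (simp add: Cons.IH add_block_def add.assoc)
qed simp

lemma first_index_unique: "distinct xs \<Longrightarrow> t < length xs \<Longrightarrow> first_index xs (xs ! t) = t"
proof (induction xs arbitrary: t)
  case (Cons x xs)
  then show ?case by (cases t) auto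
qed simp

lemma image_first_index:
  assumes "distinct xs" "S \<subseteq> set xs"
  shows "first_index xs ` S = {t. t < length xs \<and> xs ! t \<in> S}"
proof (intro equalityI subsetI)
  fix t assume "t \<in> first_index xs ` S"
  then obtain u where "u < length xs" "xs ! u \<in> S" "t = first_index xs (xs ! u)"
    using assms(2) by (metis imageE in_set_conv_nth subsetD)
  then show "t \<in> {t. t < length xs \<and> xs ! t \<in> S}" using first_index_unique[OF assms(1)] by simp
next
  fix t assume "t \<in> {t. t < length xs \<and> xs ! t \<in> S}"
  then show "t \<in> first_index xs ` S" using first_index_unique[OF assms(1), of t] by (auto intro!: image_eqI[of _ _ "xs ! t"])
qed

text \<open>The output list is a permutation of the labels and \<open>first_index\<close> inverts
  it, so a preimage of a label interval under the output list is an image under the output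
  time.\<close>

lemma output_partition_eq:
  assumes "js \<in> Luk (length chi)"
  shows "output_partition chi js = (`) (exit_time chi (insertions js) 0 [] 0) ` label_blocks (insertions js) 0"
proof -
  define ps where "ps = insertions js"
  define out where "out = outputs chi ps 0 []"
  have m: "mset out = mset [0..<length chi]"
    unfolding out_def ps_def by (rule mset_outputs_Luk[OF assms])
  have out: "distinct out" "set out = {0..<length chi}" "length out = length chi"
    using m mset_eq_imp_distinct_iff[OF m] mset_eq_setD[OF m] mset_eq_length[OF m] by auto
  have len: "length ps = length chi" unfolding ps_def by (rule length_insertions[OF assms])
  have "feasible 0 ps" unfolding ps_def by (rule feasible_insertions[OF assms])
  then have "sum_list ps = length chi" by (simp add: feasible_iff len)
  moreover have "sum_list (take k ps) \<le> sum_list ps" for k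
    by (metis append_take_drop_id le_add1 sum_list_append)
  ultimately have le: "sum_list (take k ps) \<le> length chi" for k by simp
  have "output_times chi ps j = first_index out ` {sum_list (take j ps)..<sum_list (take (Suc j) ps)}" for j
    unfolding output_times_def out_def[symmetric]
    using le[of "Suc j"] by (subst image_first_index[OF out(1)]) (auto simp: out)
  then have "output_partition chi js = (`) (first_index out) ` label_blocks ps 0"
    unfolding output_partition_def label_blocks_eq ps_def[symmetric] len by auto
  then show ?thesis by (simp add: out_def ps_def)
qed

theorem lr_partitions_eq: "lr_partitions chi = {\<pi>. ([], \<pi>) \<in> deque_partitions chi 0}"
proof (intro equalityI subsetI)
  fix \<pi> assume "\<pi> \<in> lr_partitions chi"
  then obtain js where js: "js \<in> Luk (length chi)" "\<pi> = output_partition chi js"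
    by (auto simp: lr_partitions_def)
  have "length chi = length (insertions js)" using length_insertions[OF js(1)] by simp
  from exit_times_in_deque_partitions[OF this, of "[]" 0 0] feasible_insertions[OF js(1)]
  show "\<pi> \<in> {\<pi>. ([], \<pi>) \<in> deque_partitions chi 0}"
    by (simp add: js(2) output_partition_eq[OF js(1)])
next
  fix \<pi> assume "\<pi> \<in> {\<pi>. ([], \<pi>) \<in> deque_partitions chi 0}"
  then have "([], \<pi>) \<in> deque_partitions chi 0" by simp
  from deque_partitions_exit_times[OF this] obtain ps where ps: "length chi = length ps" "feasible 0 ps"
    and \<pi>: "\<pi> = (`) (exit_time chi ps 0 [] 0) ` label_blocks ps 0" by fastforce
  obtain js where js: "js \<in> Luk (length ps)" "insertions js = ps"
    by (rule insertions_surj[OF ps(2)])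
  then have "\<pi> = output_partition chi js" using \<pi> output_partition_eq[of js chi] ps(1) by simp
  then show "\<pi> \<in> lr_partitions chi" using js ps(1) by (auto simp: lr_partitions_def)
qed

section \<open>Moments of canonical operators\<close>

definition canonical ::
  "('d list \<Rightarrow>\<^sub>0 complex) \<Rightarrow> ('d list \<Rightarrow>\<^sub>0 complex) \<Rightarrow> side \<Rightarrow> 'd \<Rightarrow> 'd list bop" where
  "canonical f g h i = (case h of Lside \<Rightarrow> left_canonical f i | Rside \<Rightarrow> right_canonical g i)"

definition symbol_coeff ::
  "('d list \<Rightarrow>\<^sub>0 complex) \<Rightarrow> ('d list \<Rightarrow>\<^sub>0 complex) \<Rightarrow> side \<Rightarrow> 'd list \<Rightarrow> complex" where
  "symbol_coeff f g h w = (case h of Lside \<Rightarrow> Poly_Mapping.lookup f w | Rside \<Rightarrow> Poly_Mapping.lookup g w)"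

definition creation :: "side \<Rightarrow> 'd \<Rightarrow> 'd list bop" where
  "creation h = (case h of Lside \<Rightarrow> left_creation | Rside \<Rightarrow> right_creation)"

lemma bop_apply_sum: "bop_apply (\<Sum>a\<in>A. T a) x = (\<Sum>a\<in>A. bop_apply (T a) x)"
  by (induction A rule: infinite_finite_induct) auto

lemma bop_apply_sum_right: "bop_apply T (\<Sum>a\<in>A. x a) = (\<Sum>a\<in>A. bop_apply T (x a))"
  by (rule linear_sum[OF bounded_linear.linear[OF bounded_linear_bop]])

lemma bop_apply_zero_right: "bop_apply T 0 = 0"
  by (rule linear_0[OF bounded_linear.linear[OF bounded_linear_bop]])

lemma coord_sum: "coord (\<Sum>a\<in>A. x a) b = (\<Sum>a\<in>A. coord (x a) b)"
  by (induction A rule: infinite_finite_induct) auto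

text \<open>The reversal in the operator product makes the first letter of \<open>w\<close> act
  first, so the letters enter just as balls inserted one at a time.\<close>

lemma prod_list_creation_ket:
  "bop_apply (prod_list (map (creation h) (rev w))) (ket v) = ket (join h (orient h w) v)"
  by (induction w arbitrary: v; cases h)
    (auto simp: creation_def left_creation_ket right_creation_ket)

lemma adj_creation_ket: "bop_apply (adj (creation h j)) (ket (join h [j] v)) = ket v"
  by (rule ell2_eqI; cases h)
    (auto simp: creation_def coord_adj_left_creation coord_adj_right_creation coord_ket)

lemma adj_creation_ket_zero:
  "(\<And>v. u \<noteq> join h [j] v) \<Longrightarrow> bop_apply (adj (creation h j)) (ket u) = 0"
  by (rule ell2_eqI; cases h)
    (force simp: creation_def coord_adj_left_creation coord_adj_right_creation coord_ket)+

lemma join_Nil [simp]: "join h [] D = D"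
  and orient_Nil [simp]: "orient h [] = []"
  by (cases h; simp)+

text \<open>The identity summand becomes the empty word with coefficient 1, which is free because
  the symbols have no constant term; it models a move without insertion.\<close>

lemma canonical_ket:
  fixes f g :: "'d list \<Rightarrow>\<^sub>0 complex"
  assumes "Poly_Mapping.lookup f [] = 0" "Poly_Mapping.lookup g [] = 0"
  defines "c \<equiv> \<lambda>h w. if w = [] then 1 else symbol_coeff f g h w"
  assumes W: "finite W" "[] \<in> W" "Poly_Mapping.keys f \<union> Poly_Mapping.keys g \<subseteq> W"
  shows "bop_apply (canonical f g h j) (ket v) =
    (\<Sum>w\<in>W. c h w *\<^sub>C bop_apply (adj (creation h j)) (ket (join h (orient h w) v)))"
proof -
  define p where "p = (case h of Lside \<Rightarrow> f | Rside \<Rightarrow> g)"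
  have p: "Poly_Mapping.lookup p [] = 0" "Poly_Mapping.keys p \<subseteq> W"
    and c: "c h w = (if w = [] then 1 else Poly_Mapping.lookup p w)" for w
    using assms by (auto simp: p_def symbol_coeff_def split: side.splits)
  let ?K = "\<lambda>w. ket (join h (orient h w) v)"
  have "canonical f g h j = adj (creation h j) * (1 + (\<Sum>w\<in>Poly_Mapping.keys p.
      scale_bop (Poly_Mapping.lookup p w) (prod_list (map (creation h) (rev w)))))"
    by (cases h) (simp_all add: canonical_def left_canonical_def right_canonical_def p_def creation_def)
  then have "bop_apply (canonical f g h j) (ket v) = bop_apply (adj (creation h j))
      (ket v + (\<Sum>w\<in>Poly_Mapping.keys p. Poly_Mapping.lookup p w *\<^sub>C ?K w))"
    by (simp add: bop_apply_sum prod_list_creation_ket)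
  also have "ket v + (\<Sum>w\<in>Poly_Mapping.keys p. Poly_Mapping.lookup p w *\<^sub>C ?K w) = (\<Sum>w\<in>W. c h w *\<^sub>C ?K w)"
  proof -
    have "(\<Sum>w\<in>W. c h w *\<^sub>C ?K w) = c h [] *\<^sub>C ?K [] + (\<Sum>w\<in>W - {[]}. c h w *\<^sub>C ?K w)"
      by (rule sum.remove[OF W(1,2)])
    also have "c h [] *\<^sub>C ?K [] = ket v"
      by (rule ell2_eqI) (simp add: c)
    also have "(\<Sum>w\<in>W - {[]}. c h w *\<^sub>C ?K w) = (\<Sum>w\<in>Poly_Mapping.keys p. Poly_Mapping.lookup p w *\<^sub>C ?K w)"
      by (rule sum.mono_neutral_cong_right)
        (use W p in \<open>auto simp: c in_keys_iff intro: ell2_eqI\<close>)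
    finally show ?thesis by simp
  qed
  finally show ?thesis by (simp add: bop_apply_sum_right bop_apply_scale)
qed

section \<open>Sums over deque partitions and vacuum moments\<close>

lemma subseq_join_right: "subseq D (join h B D)"
  and subseq_join_left: "subseq B (join h B D)"
  and subseq_join_mono: "subseq D D' \<Longrightarrow> subseq (join h B D) (join h B D')"
  by (cases h; simp add: subseq_drop_many subseq_rev_drop_many subseq_append')+

lemma exit_order_drop_subseq:
  assumes "i \<le> length chi"
  shows "subseq (exit_order (drop i chi) i) (exit_order chi 0)"
  using assms
proof (induction i)
  case (Suc i)
  then have "exit_order (drop i chi) i = join (chi ! i) [i] (exit_order (drop (Suc i) chi) (Suc i))"
    by (simp add: Cons_nth_drop_Suc[symmetric])
  then show ?case
    using Suc subseq_join_right subseq_order.order_trans by (metis Suc_leD)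
qed simp

lemma deque_partitionsD:
  assumes "(D, \<pi>) \<in> deque_partitions hs i"
  shows "subseq D (exit_order hs i)" "set D \<subseteq> {i..<i + length hs}" "distinct D"
    "partition_on ({i..<i + length hs} - set D) \<pi>" "\<Union>\<pi> \<subseteq> {i..<i + length hs}" "finite \<pi>"
proof -
  have adm: "admissible (exit_order hs i) D \<pi>" using assms by (simp add: deque_partitions_iff)
  then show D: "subseq D (exit_order hs i)" and p: "partition_on ({i..<i + length hs} - set D) \<pi>"
    by (auto simp: admissible_def set_exit_order)
  show "set D \<subseteq> {i..<i + length hs}" using subseq_subset[OF D] by (simp add: set_exit_order)
  show "distinct D" using D distinct_exit_order filter_subseq_distinct distinct_filter by metis
  show "\<Union>\<pi> \<subseteq> {i..<i + length hs}" using p by (auto simp: partition_on_def)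
  show "finite \<pi>" using finite_elements[OF _ p] by simp
qed

lemma finite_splits: "finite {(B, D). E = join h B D}"
proof (rule finite_subset)
  let ?L = "{xs. set xs \<subseteq> set E \<and> length xs \<le> length E}"
  show "{(B, D). E = join h B D} \<subseteq> ?L \<times> ?L" by auto
  show "finite (?L \<times> ?L)" by (intro finite_cartesian_product finite_lists_length_le) auto
qed

lemma finite_deque_partitions: "finite (deque_partitions hs i)"
proof (rule finite_subset)
  let ?n = "length hs"
  show "deque_partitions hs i \<subseteq> {xs. set xs \<subseteq> {i..<i + ?n} \<and> length xs \<le> ?n} \<times> Pow (Pow {i..<i + ?n})"
  proof clarify
    fix D \<pi> assume *: "(D, \<pi>) \<in> deque_partitions hs i"
    have "length D \<le> ?n"
      using card_mono[OF _ deque_partitionsD(2)[OF *]] distinct_card[OF deque_partitionsD(3)[OF *]] by simp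
    then show "D \<in> {xs. set xs \<subseteq> {i..<i + ?n} \<and> length xs \<le> ?n} \<and> \<pi> \<in> Pow (Pow {i..<i + ?n})"
      using deque_partitionsD(2,5)[OF *] by auto
  qed
qed (intro finite_cartesian_product finite_lists_length_le; simp)

text \<open>The recursion reaches every pair exactly once. From \<open>D\<close> and
  \<open>add_block B \<pi>\<close> the step can be read off: \<open>B\<close> is empty iff
  \<open>i\<close> is in \<open>D\<close>, otherwise \<open>B\<close> is the block of
  \<open>i\<close> listed in exit order; then \<open>\<pi>\<close> and \<open>D'\<close> follow by
  cancellation.\<close>

lemma sum_deque_partitions_Cons:
  fixes F :: "nat list \<Rightarrow> nat set set \<Rightarrow> 'b :: comm_monoid_add"
  shows "(\<Sum>(D, \<pi>)\<in>deque_partitions (h # hs) i. F D \<pi>) =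
    (\<Sum>(D', \<pi>)\<in>deque_partitions hs (Suc i). \<Sum>(B, D)\<in>{(B, D). join h [i] D' = join h B D}. F D (add_block B \<pi>))"
proof -
  define Z where "Z = (SIGMA y:deque_partitions hs (Suc i). {(B, D). join h [i] (fst y) = join h B D})"
  define \<Phi> where "\<Phi> = (\<lambda>((D' :: nat list, \<pi> :: nat set set), (B :: nat list, D :: nat list)). (D, add_block B \<pi>))"
  have im: "deque_partitions (h # hs) i = \<Phi> ` Z"
  proof (intro equalityI subsetI)
    fix x assume "x \<in> deque_partitions (h # hs) i"
    then obtain D B D' \<pi> where "x = (D, add_block B \<pi>)" "(D', \<pi>) \<in> deque_partitions hs (Suc i)"
      "join h [i] D' = join h B D" by auto
    then show "x \<in> \<Phi> ` Z"
      by (intro image_eqI[of _ _ "((D', \<pi>), B, D)"]) (simp_all add: Z_def \<Phi>_def)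
  next
    fix x assume "x \<in> \<Phi> ` Z"
    then obtain D' \<pi> B D where "x = (D, add_block B \<pi>)" "(D', \<pi>) \<in> deque_partitions hs (Suc i)"
      "join h [i] D' = join h B D" by (auto simp: Z_def \<Phi>_def)
    then show "x \<in> deque_partitions (h # hs) i" by auto
  qed
  have inj: "inj_on \<Phi> Z"
  proof (rule inj_onI)
    fix z1 z2 assume zZ: "z1 \<in> Z" "z2 \<in> Z" "\<Phi> z1 = \<Phi> z2"
    obtain D1 \<pi>1 B1 E1 where z1: "z1 = ((D1, \<pi>1), B1, E1)" by (metis prod.exhaust)
    obtain D2 \<pi>2 B2 E2 where z2: "z2 = ((D2, \<pi>2), B2, E2)" by (metis prod.exhaust)
    note Z1 = zZ(1)[unfolded z1] and Z2 = zZ(2)[unfolded z2] and eq = zZ(3)[unfolded z1 z2]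
    have E: "E1 = E2" "add_block B1 \<pi>1 = add_block B2 \<pi>2" using eq by (auto simp: \<Phi>_def)
    have *: "subseq B (exit_order (h # hs) i) \<and> i \<notin> \<Union>\<pi> \<and> (i \<in> set B \<longleftrightarrow> B \<noteq> []) \<and> (i \<in> set E \<longleftrightarrow> B = []) \<and>
        join h [i] D = join h B E"
      if Z: "((D, \<pi>), B, E) \<in> Z" for D \<pi> B E
    proof -
      have d: "(D, \<pi>) \<in> deque_partitions hs (Suc i)" and j: "join h [i] D = join h B E"
        using Z by (auto simp: Z_def)
      have "subseq (join h [i] D) (exit_order (h # hs) i)"
        using subseq_join_mono[OF deque_partitionsD(1)[OF d]] by simp
      then have sB: "subseq B (exit_order (h # hs) i)"
        unfolding j using subseq_join_left subseq_order.order_trans by blast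
      have "distinct (join h [i] D)" using deque_partitionsD(2,3)[OF d] by auto
      then have disj: "set B \<inter> set E = {}" unfolding j by simp
      have "i \<in> set B" if "B \<noteq> []"
        using j that by (cases h) (auto simp: Cons_eq_append_conv append_eq_Cons_conv dest: arg_cong[of _ _ last])
      moreover have "i \<in> set B \<union> set E" using arg_cong[OF j, of set] by auto
      ultimately have "(i \<in> set B \<longleftrightarrow> B \<noteq> []) \<and> (i \<in> set E \<longleftrightarrow> B = [])" using disj by auto
      then show ?thesis using sB j deque_partitionsD(5)[OF d] by fastforce
    qed
    note 1 = *[OF Z1] and 2 = *[OF Z2]
    have "B1 = B2 \<and> \<pi>1 = \<pi>2"
    proof (cases "B1 = []")
      case True
      then have "B2 = []" using 1 2 E by simp
      then show ?thesis using True E by (simp add: add_block_def)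
    next
      case False
      then have "B2 \<noteq> []" using 1 2 E by auto
      then have ins: "insert (set B1) \<pi>1 = insert (set B2) \<pi>2" using False E by (simp add: add_block_def)
      have i: "i \<in> set B1" "i \<in> set B2" "i \<notin> \<Union>\<pi>1" "i \<notin> \<Union>\<pi>2" using False \<open>B2 \<noteq> []\<close> 1 2 by auto
      \<comment> \<open>The new block is the only one containing \<open>i\<close> on either side of
        \<open>ins\<close>.\<close>
      then have sB: "set B1 = set B2" using ins by blast
      then have "B1 = B2"
        using filter_subseq_distinct[OF _ distinct_exit_order] 1 2 by metis
      moreover have "set B2 \<notin> \<pi>1" "set B2 \<notin> \<pi>2" using i by blast+
      then have "\<pi>1 = \<pi>2" using ins unfolding sB by (simp add: insert_ident)
      ultimately show ?thesis by simp
    qed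
    moreover have "join h [i] D1 = join h [i] D2" using 1 2 E(1) calculation by simp
    then have "D1 = D2" by (simp add: join_eq_iff)
    ultimately show "z1 = z2" using E z1 z2 by simp
  qed
  have "(\<Sum>(D, \<pi>)\<in>deque_partitions (h # hs) i. F D \<pi>) = (\<Sum>z\<in>Z. case \<Phi> z of (D, \<pi>) \<Rightarrow> F D \<pi>)"
    unfolding im by (simp add: sum.reindex[OF inj] o_def)
  also have "\<dots> = (\<Sum>y\<in>deque_partitions hs (Suc i). \<Sum>z\<in>{(B, D). join h [i] (fst y) = join h B D}.
      case \<Phi> (y, z) of (D, \<pi>) \<Rightarrow> F D \<pi>)"
    unfolding Z_def by (subst sum.Sigma) (auto simp: finite_deque_partitions finite_splits)
  also have "\<dots> = (\<Sum>(D', \<pi>)\<in>deque_partitions hs (Suc i). \<Sum>(B, D)\<in>{(B, D). join h [i] D' = join h B D}. F D (add_block B \<pi>))"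
    by (intro sum.cong refl) (auto simp: \<Phi>_def intro!: sum.cong)
  finally show ?thesis .
qed

text \<open>Each sum has at most one nonzero term: the length of \<open>v\<close> fixes where
  \<open>E\<close> is cut, and the letters cut off determine \<open>w\<close>. Distinct entries of
  \<open>E\<close> may carry the same letter without harm.\<close>

lemma sum_words_eq_sum_splits:
  fixes c :: "'d list \<Rightarrow> complex" and l :: "'a \<Rightarrow> 'd"
  assumes W: "finite W" "\<And>w. w \<notin> W \<Longrightarrow> c w = 0"
  shows "(\<Sum>w\<in>W. if map l E = join h (orient h w) v then c w else 0) =
    (\<Sum>(B, D)\<in>{(B, D). E = join h B D}. if map l D = v then c (orient h (map l B)) else 0)"
proof (cases "\<exists>B D. E = join h B D \<and> map l D = v")
  case True
  then obtain B D where BD: "E = join h B D" "map l D = v" by blast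
  have "map l E = join h (orient h w) v \<longleftrightarrow> w = orient h (map l B)" for w
    using BD by (auto simp: map_join join_eq_iff)
  then have "(\<Sum>w\<in>W. if map l E = join h (orient h w) v then c w else 0) =
      (\<Sum>w\<in>W. if w = orient h (map l B) then c w else 0)" by simp
  also have "\<dots> = c (orient h (map l B))" using W by simp
  also have "\<dots> = (\<Sum>(B', D')\<in>{(B, D)}. if map l D' = v then c (orient h (map l B')) else 0)"
    using BD by simp
  also have "\<dots> = (\<Sum>(B, D)\<in>{(B, D). E = join h B D}. if map l D = v then c (orient h (map l B)) else 0)"
  proof (rule sum.mono_neutral_left[OF finite_splits])
    have "B' = B \<and> D' = D" if "E = join h B' D'" "map l D' = v" for B' D'
    proof -
      have "length D = length D'" using that BD by (metis length_map)
      then show ?thesis using that BD join_eq_iff[of B B' D D' h] by simp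
    qed
    then show "\<forall>z\<in>{(B, D). E = join h B D} - {(B, D)}.
        (case z of (B, D) \<Rightarrow> if map l D = v then c (orient h (map l B)) else 0) = 0"
      by (auto split: if_splits)
  qed (use BD in auto)
  finally show ?thesis .
next
  case False
  have "map l E \<noteq> join h u v" for u
  proof
    assume "map l E = join h u v"
    then have "\<exists>B D. E = join h B D \<and> map l D = v"
      by (cases h) (auto simp: map_eq_append_conv)
    then show False using False by blast
  qed
  moreover have "(case z of (B, D) \<Rightarrow> if map l D = v then c (orient h (map l B)) else 0) = 0"
    if "z \<in> {(B, D). E = join h B D}" for z using False that by auto
  ultimately show ?thesis by (simp add: sum.neutral)
qed

text \<open>Induction downwards on \<open>i\<close>, whose operator acts first. The vector
  \<open>ket v\<close> is read as a deque whose balls, named by output times, carry the letters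
  \<open>l t\<close>. A move inserting a block also removes one of its balls, so
  \<open>Min V\<close> is the move that inserts \<open>V\<close>, and its side selects the
  symbol.\<close>

lemma prod_list_canonical_ket:
  fixes f g :: "'d list \<Rightarrow>\<^sub>0 complex" and l :: "nat \<Rightarrow> 'd" and chi :: "side list"
  assumes "Poly_Mapping.lookup f [] = 0" "Poly_Mapping.lookup g [] = 0"
  defines "ord \<equiv> exit_order chi 0"
  defines "weight \<equiv> \<lambda>V. symbol_coeff f g (chi ! Min V) (map l (orient (chi ! Min V) (filter (\<lambda>t. t \<in> V) ord)))"
  assumes "i \<le> length chi"
  shows "coord (bop_apply (prod_list (rev (map (\<lambda>t. canonical f g (chi ! t) (l t)) [i..<length chi]))) (ket v)) [] =
    (\<Sum>(D, \<pi>)\<in>deque_partitions (drop i chi) i. if map l D = v then \<Prod>V\<in>\<pi>. weight V else 0)"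
  using assms(5)
proof (induction arbitrary: v rule: inc_induct)
  case base
  show ?case by (auto simp: coord_ket)
next
  case (step i)
  define W where "W = insert [] (Poly_Mapping.keys f \<union> Poly_Mapping.keys g)"
  have W: "finite W" "[] \<in> W" "Poly_Mapping.keys f \<union> Poly_Mapping.keys g \<subseteq> W" by (auto simp: W_def)
  define h where "h = chi ! i"
  define c where "c = (\<lambda>w. if w = [] then 1 else symbol_coeff f g h w)"
  have c0: "c w = 0" if "w \<notin> W" for w
    using that by (auto simp: c_def W_def symbol_coeff_def in_keys_iff split: side.split)
  define P where "P = prod_list (rev (map (\<lambda>t. canonical f g (chi ! t) (l t)) [Suc i..<length chi]))"
  define Y where "Y = deque_partitions (drop (Suc i) chi) (Suc i)"
  define wt where "wt \<pi> = (\<Prod>V\<in>\<pi>. weight V)" for \<pi>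
  have drop: "drop i chi = h # drop (Suc i) chi" using step.hyps by (simp add: h_def Cons_nth_drop_Suc)
  have IH: "coord (bop_apply P (ket u)) [] = (\<Sum>(D, \<pi>)\<in>Y. if map l D = u then wt \<pi> else 0)" for u
    using step.IH[of u] unfolding P_def Y_def wt_def .
  \<comment> \<open>The annihilation operator leaves a nonzero vector only if the letter at the end
    of \<open>u\<close> is \<open>l i\<close>; the ball removed there receives output time
    \<open>i\<close>.\<close>
  have remove: "coord (bop_apply P (bop_apply (adj (creation h (l i))) (ket u))) [] =
      (\<Sum>(D, \<pi>)\<in>Y. if map l (join h [i] D) = u then wt \<pi> else 0)" for u
  proof (cases "\<exists>u'. u = join h [l i] u'")
    case True
    then obtain u' where u': "u = join h [l i] u'" by blast
    show ?thesis unfolding u' adj_creation_ket IH by (simp add: map_join join_eq_iff)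
  next
    case False
    then have "(\<Sum>(D, \<pi>)\<in>Y. if map l (join h [i] D) = u then wt \<pi> else 0) = 0"
      by (intro sum.neutral) (auto simp: map_join)
    then show ?thesis using False by (simp add: adj_creation_ket_zero bop_apply_zero_right)
  qed
  \<comment> \<open>The word inserted by the move becomes a block cut from the deque, and its
    coefficient becomes the weight of that block.\<close>
  have inner: "(\<Sum>w\<in>W. c w * (if map l (join h [i] D') = join h (orient h w) v then wt \<pi> else 0)) =
      (\<Sum>(B, D)\<in>{(B, D). join h [i] D' = join h B D}. if map l D = v then wt (add_block B \<pi>) else 0)"
    if Y: "(D', \<pi>) \<in> Y" for D' \<pi>
  proof -
    have "(\<Sum>w\<in>W. c w * (if map l (join h [i] D') = join h (orient h w) v then wt \<pi> else 0)) =
        (\<Sum>w\<in>W. if map l (join h [i] D') = join h (orient h w) v then c w else 0) * wt \<pi>"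
      unfolding sum_distrib_right by (intro sum.cong) auto
    also have "\<dots> = (\<Sum>(B, D)\<in>{(B, D). join h [i] D' = join h B D}.
        if map l D = v then c (orient h (map l B)) else 0) * wt \<pi>"
      by (rule arg_cong[of _ _ "\<lambda>x. x * wt \<pi>"], rule sum_words_eq_sum_splits[OF W(1) c0])
    also have "\<dots> = (\<Sum>(B, D)\<in>{(B, D). join h [i] D' = join h B D}. if map l D = v then wt (add_block B \<pi>) else 0)"
      unfolding sum_distrib_right
    proof (intro sum.cong refl, clarify)
      fix B D assume eq: "join h [i] D' = join h B D"
      have "c (orient h (map l B)) * wt \<pi> = wt (add_block B \<pi>)"
      proof (cases "B = []")
        case False
        note Yd = Y[unfolded Y_def]
        have i: "i \<in> set B"
          using eq False by (cases h) (auto simp: Cons_eq_append_conv append_eq_Cons_conv dest: arg_cong[of _ _ last])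
        then have "set B \<notin> \<pi>" using deque_partitionsD(5)[OF Yd] by fastforce
        then have "wt (add_block B \<pi>) = weight (set B) * wt \<pi>"
          using False deque_partitionsD(6)[OF Yd] by (simp add: wt_def add_block_def)
        moreover have "weight (set B) = c (orient h (map l B))"
        proof -
          have "set B \<subseteq> {i..}"
            using arg_cong[OF eq, of set] deque_partitionsD(2)[OF Yd] by fastforce
          then have "Min (set B) = i" using i by (intro Min_eqI) auto
          moreover have "subseq (join h [i] D') (exit_order (drop i chi) i)"
            using subseq_join_mono[OF deque_partitionsD(1)[OF Yd]] by (simp add: drop)
          then have "subseq B ord"
            unfolding eq ord_def using exit_order_drop_subseq[of i chi] step.hyps subseq_join_left
            by (metis less_imp_le subseq_order.order_trans)
          then have "filter (\<lambda>t. t \<in> set B) ord = B"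
            unfolding ord_def by (intro filter_subseq_distinct distinct_exit_order)
          ultimately show ?thesis using False by (simp add: weight_def c_def h_def map_orient)
        qed
        ultimately show ?thesis by simp
      qed (simp add: c_def add_block_def)
      then show "(if map l D = v then c (orient h (map l B)) else 0) * wt \<pi> = (if map l D = v then wt (add_block B \<pi>) else 0)"
        by simp
    qed
    finally show ?thesis .
  qed
  have "coord (bop_apply (prod_list (rev (map (\<lambda>t. canonical f g (chi ! t) (l t)) [i..<length chi]))) (ket v)) [] =
      coord (bop_apply P (bop_apply (canonical f g h (l i)) (ket v))) []"
    using step.hyps by (simp add: upt_conv_Cons P_def h_def)
  also have "\<dots> = (\<Sum>w\<in>W. c w * coord (bop_apply P (bop_apply (adj (creation h (l i))) (ket (join h (orient h w) v)))) [])"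
    by (subst canonical_ket[OF assms(1,2) W]) (simp add: bop_apply_sum_right coord_sum bop_apply_scale c_def)
  also have "\<dots> = (\<Sum>(D', \<pi>)\<in>Y. \<Sum>w\<in>W. c w * (if map l (join h [i] D') = join h (orient h w) v then wt \<pi> else 0))"
    unfolding remove sum_distrib_left by (subst sum.swap) (simp add: case_prod_unfold)
  also have "\<dots> = (\<Sum>(D', \<pi>)\<in>Y. \<Sum>(B, D)\<in>{(B, D). join h [i] D' = join h B D}. if map l D = v then wt (add_block B \<pi>) else 0)"
    by (rule sum.cong[OF refl]) (auto simp: inner)
  also have "\<dots> = (\<Sum>(D, \<pi>)\<in>deque_partitions (drop i chi) i. if map l D = v then wt \<pi> else 0)"
    unfolding drop Y_def by (rule sum_deque_partitions_Cons[symmetric])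
  finally show ?case unfolding wt_def .
qed

corollary vacuum_state_canonical:
  fixes f g :: "'d list \<Rightarrow>\<^sub>0 complex" and l :: "nat \<Rightarrow> 'd" and chi :: "side list"
  assumes "Poly_Mapping.lookup f [] = 0" "Poly_Mapping.lookup g [] = 0"
  shows "vacuum_state (prod_list (rev (map (\<lambda>t. canonical f g (chi ! t) (l t)) [0..<length chi]))) =
    (\<Sum>\<pi>\<in>lr_partitions chi. \<Prod>V\<in>\<pi>. symbol_coeff f g (chi ! Min V)
      (map l (orient (chi ! Min V) (filter (\<lambda>t. t \<in> V) (exit_order chi 0)))))"
proof -
  define w where "w = (\<lambda>V. symbol_coeff f g (chi ! Min V)
      (map l (orient (chi ! Min V) (filter (\<lambda>t. t \<in> V) (exit_order chi 0)))))"
  have "vacuum_state (prod_list (rev (map (\<lambda>t. canonical f g (chi ! t) (l t)) [0..<length chi]))) =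
      (\<Sum>(D, \<pi>)\<in>deque_partitions chi 0. if map l D = [] then \<Prod>V\<in>\<pi>. w V else 0)"
    using prod_list_canonical_ket[OF assms le0, of chi l "[]"]
    unfolding w_def by (simp add: vacuum_state_def vacuum_def cinner_ket)
  \<comment> \<open>The vacuum is the empty word, so only the empty deque contributes.\<close>
  also have "\<dots> = (\<Sum>(D, \<pi>)\<in>Pair ([] :: nat list) ` lr_partitions chi. \<Prod>V\<in>\<pi>. w V)"
    by (rule sum.mono_neutral_cong_right) (auto simp: finite_deque_partitions lr_partitions_eq)
  also have "\<dots> = (\<Sum>\<pi>\<in>lr_partitions chi. \<Prod>V\<in>\<pi>. w V)"
    by (subst sum.reindex) (auto simp: inj_on_def)
  finally show ?thesis by (simp only: w_def)
qed

section \<open>Reversal of time\<close>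

lemma exit_order_eq:
  "exit_order hs i = filter (\<lambda>t. hs ! (t - i) = Lside) [i..<i + length hs] @
     rev (filter (\<lambda>t. hs ! (t - i) = Rside) [i..<i + length hs])"
proof (induction hs arbitrary: i)
  case (Cons h hs)
  have "filter (\<lambda>t. (h # hs) ! (t - i) = s) [Suc i..<Suc (i + length hs)] =
      filter (\<lambda>t. hs ! (t - Suc i) = s) [Suc i..<Suc (i + length hs)]" for s
    by (rule filter_cong[OF refl]) (auto simp: nth_Cons')
  moreover have "[i..<i + length (h # hs)] = i # [Suc i..<Suc (i + length hs)]"
    by (simp add: upt_conv_Cons del: upt_Suc)
  ultimately show ?case by (cases h) (simp_all add: Cons.IH del: upt_Suc)
qed simp

definition mirror :: "nat \<Rightarrow> nat \<Rightarrow> nat" where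
  "mirror n t = n - Suc t"

lemma mirror_mirror [simp]: "t < n \<Longrightarrow> mirror n (mirror n t) = t"
  and mirror_less [simp]: "t < n \<Longrightarrow> mirror n t < n"
  by (auto simp: mirror_def)

lemma image_mirror_mirror: "V \<subseteq> {..<n} \<Longrightarrow> mirror n ` mirror n ` V = V"
  by (force simp: image_image)

lemma image_mirror: "mirror n ` {..<n} = {..<n}"
proof
  show sub: "mirror n ` {..<n} \<subseteq> {..<n}" by auto
  show "{..<n} \<subseteq> mirror n ` {..<n}"
    using image_mono[OF sub, of "mirror n"] by (simp add: image_mirror_mirror)
qed

lemma nth_rev_mirror: "t < length xs \<Longrightarrow> rev xs ! t = xs ! mirror (length xs) t"
  by (simp add: rev_nth mirror_def)

lemma map_mirror_upt: "map (mirror n) [0..<n] = rev [0..<n]"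
  by (rule nth_equalityI) (auto simp: rev_nth mirror_def)

text \<open>Reversing \<open>exit_order chi 0\<close> as a whole and then exchanging its left and
  right parts gives the same list, so the two orders have the same noncrossing partitions.\<close>

lemma map_mirror_exit_order:
  fixes chi :: "side list"
  defines "n \<equiv> length chi"
  shows "map (mirror n) (exit_order (rev chi) 0) =
    rev (filter (\<lambda>t. chi ! t = Lside) [0..<n]) @ filter (\<lambda>t. chi ! t = Rside) [0..<n]"
proof -
  have "map (mirror n) (filter (\<lambda>t. rev chi ! t = h) [0..<n]) = rev (filter (\<lambda>t. chi ! t = h) [0..<n])" for h
  proof -
    have "filter (\<lambda>t. rev chi ! t = h) [0..<n] = filter ((\<lambda>t. chi ! t = h) \<circ> mirror n) [0..<n]"
      by (rule filter_cong[OF refl]) (simp add: n_def nth_rev_mirror)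
    then show ?thesis
      by (simp add: filter_map[symmetric] map_mirror_upt rev_filter)
  qed
  then show ?thesis by (simp add: exit_order_eq n_def[symmetric] flip: rev_map)
qed

lemma noncrossing_mirror:
  assumes "noncrossing (map (mirror n) xs) {} \<pi>" "set xs \<subseteq> {..<n}" "\<Union>\<pi> \<subseteq> {..<n}"
  shows "noncrossing xs {} ((`) (mirror n) ` \<pi>)"
proof (rule noncrossingI)
  fix V W a b c d
  assume VW: "V \<in> (`) (mirror n) ` \<pi>" "W \<in> (`) (mirror n) ` \<pi>" "V \<noteq> W"
    and s: "subseq [a, b, c, d] xs" and mem: "a \<in> V" "b \<in> W" "c \<in> V" "d \<in> W"
  obtain V' W' where V': "V' \<in> \<pi>" "V = mirror n ` V'" and W': "W' \<in> \<pi>" "W = mirror n ` W'"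
    using VW by auto
  have inv: "mirror n x \<in> U'" if "x \<in> mirror n ` U'" "U' \<in> \<pi>" for x U'
    using that assms(3) by auto
  have "subseq [mirror n a, mirror n b, mirror n c, mirror n d] (map (mirror n) xs)"
    using subseq_map[OF s, of "mirror n"] by simp
  then show False
    using noncrossing_crossD[OF assms(1) V'(1) W'(1)] VW(3) mem inv V' W' by metis
qed simp

lemma noncrossing_mirror_chi:
  fixes chi :: "side list"
  defines "n \<equiv> length chi"
  assumes "noncrossing (exit_order chi 0) {} \<pi>" "\<Union>\<pi> \<subseteq> {..<n}"
  shows "noncrossing (exit_order (rev chi) 0) {} ((`) (mirror n) ` \<pi>)"
proof (rule noncrossing_mirror)
  let ?A = "\<lambda>h. filter (\<lambda>t. chi ! t = h) [0..<n]"
  have "noncrossing (?A Lside @ rev (?A Rside)) {} \<pi>"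
    using assms by (simp add: exit_order_eq)
  then have "noncrossing (rev (?A Rside) @ ?A Lside) {} \<pi>" by (rule noncrossing_rotate)
  then have "noncrossing (rev (rev (?A Rside) @ ?A Lside)) {} \<pi>" by (rule noncrossing_rev)
  then show "noncrossing (map (mirror n) (exit_order (rev chi) 0)) {} \<pi>"
    unfolding n_def map_mirror_exit_order by simp
qed (use assms in \<open>auto simp: set_exit_order\<close>)

text \<open>The deque starts empty, so \<open>S\<close> is empty and plain noncrossing with respect
  to the exit order remains.\<close>

lemma lr_partitions_iff:
  "\<pi> \<in> lr_partitions chi \<longleftrightarrow> partition_on {..<length chi} \<pi> \<and> noncrossing (exit_order chi 0) {} \<pi>"
  by (auto simp: lr_partitions_eq deque_partitions_iff admissible_def set_exit_order atLeast0LessThan)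

lemma inj_on_mirror: "inj_on (mirror n) {..<n}"
  by (rule inj_on_inverseI[of _ "mirror n"]) simp

lemma mirror_lr_partitions:
  assumes "\<pi> \<in> lr_partitions chi"
  shows "(`) (mirror (length chi)) ` \<pi> \<in> lr_partitions (rev chi)"
proof -
  let ?n = "length chi"
  have p: "partition_on {..<?n} \<pi>" and nc: "noncrossing (exit_order chi 0) {} \<pi>"
    using assms by (auto simp: lr_partitions_iff)
  have U: "\<Union>\<pi> \<subseteq> {..<?n}" using p by (auto simp: partition_on_def)
  have "{} \<notin> (`) (mirror ?n) ` \<pi>" using p by (auto simp: partition_on_def)
  then have "partition_on {..<?n} ((`) (mirror ?n) ` \<pi>)"
    using partition_on_inj_image[OF p inj_on_mirror] by (simp add: image_mirror)
  then show ?thesis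
    using noncrossing_mirror_chi[OF nc U] by (simp add: lr_partitions_iff)
qed

lemma bij_betw_mirror_lr_partitions:
  "bij_betw ((`) ((`) (mirror (length chi)))) (lr_partitions chi) (lr_partitions (rev chi))"
proof (rule bij_betw_byWitness[where f' = "(`) ((`) (mirror (length chi)))"])
  have *: "(`) (mirror (length chi)) ` (`) (mirror (length chi)) ` \<pi> = \<pi>" if "\<Union>\<pi> \<subseteq> {..<length chi}" for \<pi>
  proof -
    have "(`) (mirror (length chi)) ` (`) (mirror (length chi)) ` \<pi> = id ` \<pi>"
      unfolding image_comp by (rule image_cong) (use that in \<open>auto simp: image_mirror_mirror Sup_le_iff\<close>)
    then show ?thesis by simp
  qed
  show "\<forall>\<pi>\<in>lr_partitions chi. (`) (mirror (length chi)) ` (`) (mirror (length chi)) ` \<pi> = \<pi>"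
    "\<forall>\<pi>\<in>lr_partitions (rev chi). (`) (mirror (length chi)) ` (`) (mirror (length chi)) ` \<pi> = \<pi>"
    using * by (auto simp: lr_partitions_iff partition_on_def)
  show "(`) ((`) (mirror (length chi))) ` lr_partitions chi \<subseteq> lr_partitions (rev chi)"
    using mirror_lr_partitions by blast
  show "(`) ((`) (mirror (length chi))) ` lr_partitions (rev chi) \<subseteq> lr_partitions chi"
    using mirror_lr_partitions[of _ "rev chi"] by auto
qed

section \<open>Weights of blocks as expected cumulants\<close>

lemma nths_eq_map_filter:
  "nths xs V = map ((!) xs) (filter (\<lambda>t. t \<in> V) [0..<length xs])"
proof -
  have "nths xs V = map ((!) xs) (nths [0..<length xs] V)"
    by (simp add: nths_map[symmetric] map_nth)
  also have "nths [0..<length xs] V = filter (\<lambda>t. t \<in> V) [0..<length xs]"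
    unfolding nths_def by (induction xs rule: rev_induct) (auto)
  finally show ?thesis .
qed

lemma nths_map_Collect:
  "nths (map f zs) {m. map k zs ! m = h} = map f (filter (\<lambda>z. k z = h) zs)"
  by (induction zs) (auto simp: nths_Cons)

text \<open>The claimed value as a function of arbitrary side lists, so that it can be evaluated at
  the restrictions of \<open>chi\<close> to blocks.\<close>

definition expected_cumulant ::
  "('d list \<Rightarrow>\<^sub>0 complex) \<Rightarrow> ('d list \<Rightarrow>\<^sub>0 complex) \<Rightarrow> side list \<Rightarrow> 'd list \<Rightarrow> complex" where
  "expected_cumulant f g chi js =
    (let lefts = nths js {m. chi ! m = Lside}; rights = nths js {m. chi ! m = Rside}
     in case last chi of
          Lside \<Rightarrow> Poly_Mapping.lookup f (rev rights @ lefts)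
        | Rside \<Rightarrow> Poly_Mapping.lookup g (rev lefts @ rights))"

lemma last_sorted: "sorted xs \<Longrightarrow> xs \<noteq> [] \<Longrightarrow> last xs = Max (set xs)"
  for xs :: "'a :: linorder list"
  by (induction xs rule: rev_induct) (auto simp: sorted_append intro!: Max_eqI[symmetric])

text \<open>Mirroring turns \<open>Min\<close> into \<open>Max\<close>, so the inserting side of the
  mirrored block is the last side of the restriction of \<open>chi\<close>. In mirrored exit order
  the block reads left letters backwards, then right letters forwards; \<open>orient\<close>
  reverses this word exactly when that side is left.\<close>

lemma expected_cumulant_block:
  fixes f g :: "'d list \<Rightarrow>\<^sub>0 complex" and chi :: "side list" and js :: "'d list"
  defines "n \<equiv> length chi"
  assumes len: "length js = n" and V: "V \<subseteq> {..<n}" "V \<noteq> {}"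
  defines "h \<equiv> rev chi ! Min (mirror n ` V)"
  shows "expected_cumulant f g (nths chi V) (nths js V) = symbol_coeff f g h
    (map (\<lambda>t. js ! mirror n t) (orient h (filter (\<lambda>t. t \<in> mirror n ` V) (exit_order (rev chi) 0))))"
proof -
  define zs where "zs = filter (\<lambda>t. t \<in> V) [0..<n]"
  have setzs: "set zs = V" using V by (auto simp: zs_def)
  have nths: "nths chi V = map ((!) chi) zs" "nths js V = map ((!) js) zs"
    by (simp_all add: nths_eq_map_filter zs_def n_def[symmetric] len)
  have fin: "finite V" using V(1) by (rule finite_subset) simp
  have Max: "Max V < n" using Max_in[OF fin V(2)] V(1) by auto
  have "Min (mirror n ` V) = mirror n (Max V)"
    using fin V(2) by (intro Min_eqI) (auto simp: mirror_def intro!: diff_le_mono2)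
  then have "h = chi ! Max V"
    using Max by (simp add: h_def nth_rev_mirror n_def[symmetric])
  moreover have ne: "zs \<noteq> []" using setzs V(2) by auto
  moreover have "last zs = Max V"
  proof -
    have "sorted zs" unfolding zs_def by (intro sorted_wrt_filter) simp
    then show ?thesis using last_sorted[of zs] ne setzs by simp
  qed
  ultimately have last: "last (nths chi V) = h"
    by (simp add: nths(1) last_map)
  define A where "A h = filter (\<lambda>t. chi ! t = h) zs" for h
  have lr: "nths (nths js V) {m. nths chi V ! m = s} = map ((!) js) (A s)" for s
    unfolding nths A_def by (rule nths_map_Collect)
  have "map (mirror n) (filter (\<lambda>t. t \<in> mirror n ` V) (exit_order (rev chi) 0)) =
      filter (\<lambda>t. t \<in> V) (map (mirror n) (exit_order (rev chi) 0))"
  proof -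
    have "t \<in> mirror n ` V \<longleftrightarrow> mirror n t \<in> V" if "t \<in> set (exit_order (rev chi) 0)" for t
      using that V(1) by (force simp: set_exit_order n_def image_iff)
    then show ?thesis by (simp add: filter_map o_def cong: filter_cong)
  qed
  also have "\<dots> = rev (A Lside) @ A Rside"
    unfolding n_def map_mirror_exit_order
    by (simp add: A_def zs_def n_def[symmetric] rev_filter conj_commute)
  finally have word: "map (\<lambda>t. js ! mirror n t) (filter (\<lambda>t. t \<in> mirror n ` V) (exit_order (rev chi) 0)) =
      map ((!) js) (rev (A Lside) @ A Rside)"
    by (metis (no_types, lifting) comp_def map_eq_conv map_map)
  show ?thesis
    unfolding map_orient word expected_cumulant_def lr last Let_def symbol_coeff_def
    by (cases h) (simp_all add: rev_map)
qed

theorem vacuum_state_moment: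
  fixes f g :: "'d list \<Rightarrow>\<^sub>0 complex" and chi :: "side list" and js :: "'d list"
  assumes "Poly_Mapping.lookup f [] = 0" "Poly_Mapping.lookup g [] = 0" "length js = length chi"
  shows "vacuum_state (prod_list (map2 (canonical f g) chi js)) =
    (\<Sum>\<pi>\<in>lr_partitions chi. \<Prod>V\<in>\<pi>. expected_cumulant f g (nths chi V) (nths js V))"
proof -
  let ?n = "length chi"
  define wt where "wt V = symbol_coeff f g (rev chi ! Min V)
      (map (\<lambda>t. js ! mirror ?n t) (orient (rev chi ! Min V) (filter (\<lambda>t. t \<in> V) (exit_order (rev chi) 0))))" for V
  \<comment> \<open>The rightmost operator acts first, so the moves follow \<open>rev chi\<close>
    and move \<open>t\<close> belongs to position \<open>mirror ?n t\<close>.\<close>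
  have "rev (map2 (canonical f g) chi js) = map (\<lambda>t. canonical f g (rev chi ! t) (js ! mirror ?n t)) [0..<?n]"
    by (rule nth_equalityI) (auto simp: rev_nth assms(3) mirror_def)
  then have "map2 (canonical f g) chi js =
      rev (map (\<lambda>t. canonical f g (rev chi ! t) (js ! mirror ?n t)) [0..<length (rev chi)])"
    by (metis length_rev rev_rev_ident)
  then have "vacuum_state (prod_list (map2 (canonical f g) chi js)) =
      (\<Sum>\<pi>\<in>lr_partitions (rev chi). \<Prod>V\<in>\<pi>. wt V)"
    unfolding wt_def by (simp only: vacuum_state_canonical[OF assms(1,2)])
  also have "\<dots> = (\<Sum>\<pi>\<in>lr_partitions chi. \<Prod>V\<in>(`) (mirror ?n) ` \<pi>. wt V)"
    by (rule sum.reindex_bij_betw[OF bij_betw_mirror_lr_partitions, symmetric])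
  also have "\<dots> = (\<Sum>\<pi>\<in>lr_partitions chi. \<Prod>V\<in>\<pi>. expected_cumulant f g (nths chi V) (nths js V))"
  proof (rule sum.cong[OF refl])
    fix \<pi> assume "\<pi> \<in> lr_partitions chi"
    then have p: "partition_on {..<?n} \<pi>" by (rule partition_on_lr_partitions)
    have V: "V \<subseteq> {..<?n}" "V \<noteq> {}" if "V \<in> \<pi>" for V
      using p that by (auto simp: partition_on_def)
    have "inj_on ((`) (mirror ?n)) \<pi>"
      by (rule inj_on_inverseI[of _ "(`) (mirror ?n)"]) (use V in \<open>auto simp: image_mirror_mirror\<close>)
    then have "(\<Prod>V\<in>(`) (mirror ?n) ` \<pi>. wt V) = (\<Prod>V\<in>\<pi>. wt (mirror ?n ` V))"
      by (simp add: prod.reindex)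
    also have "\<dots> = (\<Prod>V\<in>\<pi>. expected_cumulant f g (nths chi V) (nths js V))"
      using expected_cumulant_block[OF assms(3) V, of _ f g] by (intro prod.cong refl) (simp add: wt_def)
    finally show "(\<Prod>V\<in>(`) (mirror ?n) ` \<pi>. wt V) = (\<Prod>V\<in>\<pi>. expected_cumulant f g (nths chi V) (nths js V))" .
  qed
  finally show ?thesis .
qed

lemma nths_map2:
  assumes "length xs = length ys"
  shows "nths (map2 F xs ys) V = map2 F (nths xs V) (nths ys V)"
  using assms by (simp add: nths_eq_map_filter zip_map_map zip_same_conv_map)

theorem theorem6p2:
  fixes f g :: "'d::finite list \<Rightarrow>\<^sub>0 complex"
    and \<kappa> :: "side list \<Rightarrow> 'd list bop list \<Rightarrow> complex"
    and chi :: "side list" and js :: "'d list"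
  assumes "Poly_Mapping.lookup f [] = 0" and "Poly_Mapping.lookup g [] = 0"
    and "lr_cumulants scale_bop vacuum_state \<kappa>"
    and "chi \<noteq> []" and "length js = length chi"
  shows "\<kappa> chi (map2 (\<lambda>h i. case h of Lside \<Rightarrow> left_canonical f i | Rside \<Rightarrow> right_canonical g i) chi js) =
    (let lefts = nths js {m. chi ! m = Lside}; rights = nths js {m. chi ! m = Rside}
     in case last chi of
          Lside \<Rightarrow> Poly_Mapping.lookup f (rev rights @ lefts)
        | Rside \<Rightarrow> Poly_Mapping.lookup g (rev lefts @ rights))"
proof -
  have moment: "vacuum_state (prod_list as) =
      (\<Sum>\<pi>\<in>lr_partitions chi. \<Prod>V\<in>\<pi>. \<kappa> (nths chi V) (nths as V))"
    if "chi \<noteq> []" "length as = length chi" for chi as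
    using assms(3) that unfolding lr_cumulants_def by blast
  \<comment> \<open>The induction of \<open>lr_cumulants_unique\<close>, repeated for tuples of
    canonical operators because \<open>expected_cumulant\<close> takes letters instead of operators:
    both families give the same moments and agree on proper blocks, so the one-block terms
    agree.\<close>
  have "\<kappa> chi (map2 (canonical f g) chi js) = expected_cumulant f g chi js"
    using assms(4,5)
  proof (induction "length chi" arbitrary: chi js rule: less_induct)
    case less
    let ?as = "map2 (canonical f g) chi js"
    have "(\<Sum>\<pi>\<in>lr_partitions chi. \<Prod>V\<in>\<pi>. \<kappa> (nths chi V) (nths ?as V)) =
        (\<Sum>\<pi>\<in>lr_partitions chi. \<Prod>V\<in>\<pi>. expected_cumulant f g (nths chi V) (nths js V))"
      using moment[OF less.prems(1), of ?as] less.prems(2)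
      by (simp add: vacuum_state_moment[OF assms(1,2) less.prems(2)])
    moreover have "(\<Sum>\<pi>\<in>lr_partitions chi - {{{..<length chi}}}. \<Prod>V\<in>\<pi>. \<kappa> (nths chi V) (nths ?as V)) =
        (\<Sum>\<pi>\<in>lr_partitions chi - {{{..<length chi}}}. \<Prod>V\<in>\<pi>. expected_cumulant f g (nths chi V) (nths js V))"
    proof (rule sum.cong[OF refl], rule prod.cong[OF refl])
      fix \<pi> V assume "\<pi> \<in> lr_partitions chi - {{{..<length chi}}}" and V: "V \<in> \<pi>"
      then have \<pi>: "\<pi> \<in> lr_partitions chi" "\<pi> \<noteq> {{..<length chi}}" by auto
      show "\<kappa> (nths chi V) (nths ?as V) = expected_cumulant f g (nths chi V) (nths js V)"
        using less.hyps[OF proper_block[OF \<pi> V] length_nths_cong[OF less.prems(2)]]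
        by (simp add: nths_map2 less.prems(2))
    qed
    ultimately show ?case
      using less.prems sum_lr_partitions_split[of chi ?as \<kappa>] sum_lr_partitions_split[of chi js "expected_cumulant f g"]
      by simp
  qed
  then show ?thesis
    by (simp add: canonical_def[abs_def] expected_cumulant_def)
qed

end
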